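(* Let $K\subseteq\mathbb{R}^n$ be a nonempty compact set, let $\mu$ be a finite positive Borel measure supported on $K$, and let $p,q\in\mathbb{R}[x_1,\dots,x_n]$ be polynomials with $q(x)>0$ for all $x\in K$. Let $$val=\min_{x\in K}\frac{p(x)}{q(x)},$$ and, for $r\in\mathbb{N}$, let $$\overline{p/q}^{(r)}_K:=\min_{h\in\Sigma[x]_r}\int_K p(x)h(x)\,d\mu(x)\quad\text{s.t.}\quad\int_K q(x)h(x)\,d\mu(x)=1.$$ For a polynomial $f\in\mathbb{R}[x_1,\dots,x_n]$ let $f_{\min,K}=\min_{x\in K}f(x)$ and $$\overline f^{(r)}_K:=\min_{h\in\Sigma[x]_r}\int_K h(x)f(x)\,d\mu(x)\quad\text{s.t.}\quad\int_K h(x)\,d\mu(x)=1.$$ If, for any polynomial $f$, it holds that $\overline f^{(r)}_K-f_{\min,K}=O(\varepsilon(r))$, where $\lim_{r\to\infty}\varepsilon(r)=0$, then one also has $$\overline{p/q}^{(r)}_K-val=O(\varepsilon(r)).$$ In particular, if $K=\mathbb{S}^{n-1}$ with $n\ge2$ and $\mu=\sigma$ is the surface measure, then $\overline{p/q}^{(r)}_K-val=O(1/r^2)$.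
   Context: $\Sigma[x]_r$ is the set of sums of squares of real polynomials in $x=(x_1,\dots,x_n)$ having degree at most $2r$. $\mathbb{S}^{n-1}=\{x\in\mathbb{R}^n:\|x\|=1\}$ is the Euclidean unit sphere and $\sigma$ its surface measure. The notation $a_r=O(\varepsilon(r))$ means that there is a constant $C$, independent of $r$, with $|a_r|\le C|\varepsilon(r)|$ for all integers $r\ge1$; in the hypothesis the constant may depend on $f$, and in the conclusions it may depend on $p$, $q$, $K$, $\mu$. The function $\varepsilon$ is a fixed real function on $\mathbb{N}$, not depending on $f$. *)

theory Defs
  imports "HOL-Analysis.Analysis" "HOL-Library.Poly_Mapping"
begin

text \<open>Real polynomials in variables indexed by a finite type: finitely supported maps from
  exponent vectors to coefficients, with the convolution product of \<^theory>\<open>HOL-Library.Poly_Mapping\<close>.\<close>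

type_synonym 'n rpoly = "('n \<Rightarrow>\<^sub>0 nat) \<Rightarrow>\<^sub>0 real"

definition peval :: "'n::finite rpoly \<Rightarrow> real ^ 'n \<Rightarrow> real" where
  "peval p x = (\<Sum>m\<in>Poly_Mapping.keys p.
      Poly_Mapping.lookup p m * (\<Prod>i\<in>UNIV. (x $ i) ^ Poly_Mapping.lookup m i))"

text \<open>The zero polynomial gets degree 0, so it satisfies every bound \<open>total_degree h \<le> 2 * r\<close>.\<close>

definition total_degree :: "'n::finite rpoly \<Rightarrow> nat" where
  "total_degree p =
     Max (insert 0 ((\<lambda>m. \<Sum>i\<in>UNIV. Poly_Mapping.lookup m i) ` Poly_Mapping.keys p))"

definition SOS :: "nat \<Rightarrow> 'n::finite rpoly set" where
  "SOS r = {h. (\<exists>gs. h = (\<Sum>g\<leftarrow>gs. g ^ 2)) \<and> total_degree h \<le> 2 * r}"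

text \<open>The minimum (least element) of a set of reals, not merely its infimum; unspecified if there
  is none.\<close>

definition minimum :: "real set \<Rightarrow> real" where
  "minimum S = (LEAST v. v \<in> S)"

definition rational_upper_bound ::
    "(real ^ 'n::finite) set \<Rightarrow> (real ^ 'n) measure \<Rightarrow> 'n rpoly \<Rightarrow> 'n rpoly \<Rightarrow> nat \<Rightarrow> real" where
  "rational_upper_bound K \<mu> p q r =
     minimum {LINT x:K|\<mu>. peval p x * peval h x | h.
       h \<in> SOS r \<and> (LINT x:K|\<mu>. peval q x * peval h x) = 1}"

definition polynomial_upper_bound ::
    "(real ^ 'n::finite) set \<Rightarrow> (real ^ 'n) measure \<Rightarrow> 'n rpoly \<Rightarrow> nat \<Rightarrow> real" where
  "polynomial_upper_bound K \<mu> f r =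
     minimum {LINT x:K|\<mu>. peval h x * peval f x | h.
       h \<in> SOS r \<and> (LINT x:K|\<mu>. peval h x) = 1}"

text \<open>Unlike the library's \<open>O\<close>, which only speaks about large \<open>r\<close>, this bound is required for
  every \<open>r \<ge> 1\<close>.\<close>

definition big_O_pos :: "(nat \<Rightarrow> real) \<Rightarrow> (nat \<Rightarrow> real) \<Rightarrow> bool" where
  "big_O_pos a \<epsilon> \<longleftrightarrow> (\<exists>C. \<forall>r\<ge>1. \<bar>a r\<bar> \<le> C * \<bar>\<epsilon> r\<bar>)"

text \<open>The surface measure of the unit sphere of \<open>real ^ 'n\<close>, as a Borel measure on the whole space,
  given by polar coordinates: \<open>\<sigma> A = n * \<lambda> {x. 0 < norm x < 1 \<and> x / norm x \<in> A}\<close>, where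
  \<open>n = CARD('n)\<close> and \<open>\<lambda>\<close> is Lebesgue measure.\<close>

definition sphere_surface_measure :: "(real ^ 'n::finite) measure" where
  "sphere_surface_measure =
     scale_measure (of_nat CARD('n))
       (distr (restrict_space lborel (ball 0 1 - {0})) borel (\<lambda>x. x /\<^sub>R norm x))"

end

theory Submission
  imports Defs
begin

text \<open>
  The passage from polynomials to rational functions is a change of normalization. With \<open>v\<close> the
  minimum of \<open>p / q\<close> on \<open>K\<close>, the polynomial \<open>f = p - v * q\<close> has minimum 0 on \<open>K\<close>, and a density \<open>h\<close> that is
  optimal for \<open>f\<close> becomes feasible for \<open>p / q\<close> after division by \<open>\<integral> q h\<close>, which is bounded below by the
  minimum of \<open>q\<close>. The error is multiplied by a constant only (\<open>big_O_rational_upper_bound\<close>).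

  This uses that the bounds are attained minima. The squares in an element of \<open>SOS r\<close> have roots of
  degree at most \<open>r\<close> (\<open>SOS_combinations\<close>), so each bound is the least generalized eigenvalue of two
  quadratic forms on a finite-dimensional space. The constraint form may be degenerate, but its null
  vectors do not affect the objective (\<open>quadratic_quotient_attains_min\<close>, \<open>rational_bound_attained\<close>).

  On the sphere it remains to prove the rate \<open>1 / r\<^sup>2\<close> for polynomials. At a minimizer \<open>a\<close> of \<open>f\<close> on the
  sphere, \<open>f x - f a\<close> is at most a constant times \<open>1 - a \<bullet> x\<close>, by comparing \<open>x\<close> with its reflection in the
  axis of \<open>a\<close> (\<open>quadratic_growth_on_sphere\<close>). Hence it is enough to find densities in \<open>SOS r\<close> against
  which \<open>1 - a \<bullet> x\<close> has integral of order \<open>1 / r\<^sup>2\<close>. Powers of the Fejer kernel in the variable \<open>a \<bullet> x\<close>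
  have this property for every measure whose caps around \<open>a\<close> satisfy a doubling inequality
  (\<open>doubling_concentration\<close>, \<open>big_O_polynomial_upper_bound\<close>). For the surface measure doubling follows
  from the behaviour of Lebesgue measure under a single homothety centred at \<open>a\<close>
  (\<open>homothety_maps_cone\<close>, \<open>measure_cap_doubling\<close>).
\<close>

section \<open>Evaluation and total degree of polynomials\<close>

abbreviation const_rpoly :: "real \<Rightarrow> 'n::finite rpoly" where
  "const_rpoly c \<equiv> Poly_Mapping.single 0 c"

definition monom_val :: "('n::finite \<Rightarrow>\<^sub>0 nat) \<Rightarrow> real ^ 'n \<Rightarrow> real" where
  "monom_val m x = (\<Prod>i\<in>UNIV. (x $ i) ^ Poly_Mapping.lookup m i)"

definition mdeg :: "('n::finite \<Rightarrow>\<^sub>0 nat) \<Rightarrow> nat" where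
  "mdeg m = (\<Sum>i\<in>UNIV. Poly_Mapping.lookup m i)"

lemma monom_val_zero [simp]: "monom_val 0 x = 1"
  by (simp add: monom_val_def)

lemma monom_val_add: "monom_val (m + n) x = monom_val m x * monom_val n x"
  by (simp add: monom_val_def lookup_add power_add prod.distrib)

lemma monom_val_scaleR: "monom_val m (t *\<^sub>R x) = t ^ mdeg m * monom_val m x"
  by (simp add: monom_val_def mdeg_def power_mult_distrib prod.distrib power_sum)

lemma mdeg_zero [simp]: "mdeg 0 = 0"
  by (simp add: mdeg_def)

lemma mdeg_add: "mdeg (m + n) = mdeg m + mdeg n"
  by (simp add: mdeg_def lookup_add sum.distrib)

lemma peval_altdef: "peval p x = (\<Sum>m\<in>Poly_Mapping.keys p. Poly_Mapping.lookup p m * monom_val m x)"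
  by (simp add: peval_def monom_val_def)

lemma peval_altdef_superset:
  assumes "finite M" "Poly_Mapping.keys p \<subseteq> M"
  shows "peval p x = (\<Sum>m\<in>M. Poly_Mapping.lookup p m * monom_val m x)"
  unfolding peval_altdef
  by (rule sum.mono_neutral_left) (use assms in \<open>auto simp: in_keys_iff\<close>)

lemma peval_zero [simp]: "peval 0 x = 0"
  by (simp add: peval_def)

lemma peval_single [simp]: "peval (Poly_Mapping.single m c) x = c * monom_val m x"
  by (simp add: peval_altdef)

lemma peval_one [simp]: "peval 1 x = 1"
  using peval_single[of 0 1 x] by simp

lemma peval_add [simp]: "peval (p + q) x = peval p x + peval q x"
proof -
  let ?M = "Poly_Mapping.keys p \<union> Poly_Mapping.keys q"
  have "Poly_Mapping.keys (p + q) \<subseteq> ?M"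
    by (rule keys_add)
  then show ?thesis
    by (simp add: peval_altdef_superset[of ?M] lookup_add sum.distrib distrib_right)
qed

lemma peval_sum: "peval (sum f A) x = (\<Sum>i\<in>A. peval (f i) x)"
  by (induction A rule: infinite_finite_induct) auto

lemma peval_sum_list: "peval (sum_list ps) x = (\<Sum>p\<leftarrow>ps. peval p x)"
  by (induction ps) auto

lemma rpoly_eq_sum_single:
  fixes p :: "'n::finite rpoly"
  shows "p = (\<Sum>m\<in>Poly_Mapping.keys p. Poly_Mapping.single m (Poly_Mapping.lookup p m))"
proof (rule poly_mapping_eqI)
  fix k
  have "(\<Sum>m\<in>Poly_Mapping.keys p. Poly_Mapping.lookup p m when m = k) = Poly_Mapping.lookup p k"
    by (simp add: when_def in_keys_iff)
  then show "Poly_Mapping.lookup p k = Poly_Mapping.lookup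
      (\<Sum>m\<in>Poly_Mapping.keys p. Poly_Mapping.single m (Poly_Mapping.lookup p m)) k"
    by (simp add: lookup_sum lookup_single)
qed

lemma peval_mult [simp]:
  fixes p q :: "'n::finite rpoly"
  shows "peval (p * q) x = peval p x * peval q x"
proof -
  have "p * q = (\<Sum>m\<in>Poly_Mapping.keys p. \<Sum>n\<in>Poly_Mapping.keys q.
      Poly_Mapping.single (m + n) (Poly_Mapping.lookup p m * Poly_Mapping.lookup q n))"
    by (subst (1) rpoly_eq_sum_single[of p], subst (1) rpoly_eq_sum_single[of q])
      (simp add: sum_product mult_single)
  then have "peval (p * q) x = (\<Sum>m\<in>Poly_Mapping.keys p. \<Sum>n\<in>Poly_Mapping.keys q.
      (Poly_Mapping.lookup p m * monom_val m x) * (Poly_Mapping.lookup q n * monom_val n x))"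
    by (simp add: peval_sum monom_val_add algebra_simps)
  then show ?thesis
    by (simp add: peval_altdef sum_product)
qed

lemma peval_power [simp]: "peval (p ^ k) x = peval p x ^ k"
  by (induction k) auto

lemma total_degree_le_iff: "total_degree p \<le> d \<longleftrightarrow> (\<forall>m\<in>Poly_Mapping.keys p. mdeg m \<le> d)"
  by (simp add: total_degree_def mdeg_def)

lemma total_degree_single_le: "mdeg m \<le> d \<Longrightarrow> total_degree (Poly_Mapping.single m c) \<le> d"
  by (simp add: total_degree_le_iff)

lemma total_degree_one [simp]: "total_degree 1 = 0"
  using total_degree_single_le[of 0 0 1] by simp

lemma total_degree_add_le:
  "total_degree p \<le> d \<Longrightarrow> total_degree q \<le> d \<Longrightarrow> total_degree (p + q) \<le> d"
  using keys_add[of p q] by (auto simp: total_degree_le_iff)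

lemma total_degree_sum_le:
  "(\<And>i. i \<in> A \<Longrightarrow> total_degree (f i) \<le> d) \<Longrightarrow> total_degree (sum f A) \<le> d"
  by (induction A rule: infinite_finite_induct)
    (auto intro: total_degree_add_le simp: total_degree_le_iff[of 0])

lemma total_degree_mult_le:
  fixes p q :: "'n::finite rpoly"
  assumes "total_degree p \<le> d" "total_degree q \<le> e"
  shows "total_degree (p * q) \<le> d + e"
  unfolding total_degree_le_iff
proof
  fix m assume "m \<in> Poly_Mapping.keys (p * q)"
  then obtain a b where "m = a + b" "a \<in> Poly_Mapping.keys p" "b \<in> Poly_Mapping.keys q"
    using keys_mult[of p q] by blast
  with assms show "mdeg m \<le> d + e"
    by (simp add: total_degree_le_iff mdeg_add add_mono)
qed

lemma total_degree_power_le: "total_degree p \<le> d \<Longrightarrow> total_degree (p ^ k) \<le> k * d"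
  by (induction k) (auto dest: total_degree_mult_le[of p d "p ^ k" "k * d" for k])

lemma continuous_on_peval [continuous_intros]:
  "continuous_on S g \<Longrightarrow> continuous_on S (\<lambda>x. peval p (g x))"
  unfolding peval_def by (intro continuous_intros) auto

lemma finite_mdeg_le: "finite {m :: 'n::finite \<Rightarrow>\<^sub>0 nat. mdeg m \<le> d}"
proof (rule finite_imageD)
  have "Poly_Mapping.lookup ` {m :: 'n \<Rightarrow>\<^sub>0 nat. mdeg m \<le> d} \<subseteq> PiE UNIV (\<lambda>_. {..d})"
  proof
    fix f assume "f \<in> Poly_Mapping.lookup ` {m :: 'n \<Rightarrow>\<^sub>0 nat. mdeg m \<le> d}"
    then obtain m :: "'n \<Rightarrow>\<^sub>0 nat" where f: "f = Poly_Mapping.lookup m" and d: "mdeg m \<le> d"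
      by blast
    have "Poly_Mapping.lookup m i \<le> mdeg m" for i
      unfolding mdeg_def by (rule member_le_sum) auto
    with d have "Poly_Mapping.lookup m i \<le> d" for i
      using order_trans by blast
    then show "f \<in> PiE UNIV (\<lambda>_. {..d})"
      by (auto simp: f PiE_UNIV_domain)
  qed
  then show "finite (Poly_Mapping.lookup ` {m :: 'n \<Rightarrow>\<^sub>0 nat. mdeg m \<le> d})"
    by (rule finite_subset) (simp add: finite_PiE)
  show "inj_on Poly_Mapping.lookup {m :: 'n \<Rightarrow>\<^sub>0 nat. mdeg m \<le> d}"
    by (simp add: inj_on_def)
qed

section \<open>Degrees of the squares in a sum of squares\<close>

text \<open>If \<open>p\<close> had larger degree, the leading coefficient of \<open>q - p\<^sup>2\<close> would be negative and this difference
  could not stay nonnegative on the whole line.\<close>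

lemma degree_square_le:
  fixes p q :: "real poly"
  assumes "\<And>t. (poly p t)\<^sup>2 \<le> poly q t" and "degree q \<le> 2 * r"
  shows "degree p \<le> r"
proof (rule ccontr)
  assume "\<not> degree p \<le> r"
  then have p0: "p \<noteq> 0"
    by auto
  then have lt: "degree q < degree (p * p)"
    using \<open>\<not> degree p \<le> r\<close> assms(2) by (simp add: degree_mult_eq)
  let ?d = "p * p + - q"
  have deg: "degree ?d = degree (p * p)"
    using lt by (intro degree_add_eq_left) simp
  have "lead_coeff ?d = lead_coeff (p * p)"
    unfolding deg using lt by (simp add: coeff_eq_0)
  also have "\<dots> > 0"
    using p0 unfolding lead_coeff_mult by (metis leading_coeff_0_iff not_real_square_gt_zero)
  finally have "lead_coeff ?d > 0" .
  then obtain n where "\<And>t. t \<ge> n \<Longrightarrow> lead_coeff ?d \<le> poly ?d t"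
    using poly_pinfty_gt_lc by blast
  from this[of n] \<open>lead_coeff ?d > 0\<close> assms(1)[of n] show False
    by (simp add: power2_eq_square)
qed

text \<open>The restriction of \<open>g\<close> to the line through the origin and \<open>x\<close>; its coefficient of \<open>t ^ d\<close> is the value at
  \<open>x\<close> of the homogeneous part of \<open>g\<close> of degree \<open>d\<close>.\<close>

definition ray_poly :: "'n::finite rpoly \<Rightarrow> real ^ 'n \<Rightarrow> real poly" where
  "ray_poly g x =
     (\<Sum>m\<in>Poly_Mapping.keys g. Polynomial.monom (Poly_Mapping.lookup g m * monom_val m x) (mdeg m))"

lemma poly_ray_poly: "poly (ray_poly g x) t = peval g (t *\<^sub>R x)"
  by (simp add: ray_poly_def poly_sum poly_monom peval_altdef monom_val_scaleR mult_ac)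

lemma degree_ray_poly: "degree (ray_poly g x) \<le> total_degree g"
  unfolding ray_poly_def
proof (rule degree_sum_le)
  fix m assume "m \<in> Poly_Mapping.keys g"
  then have "mdeg m \<le> total_degree g"
    using total_degree_le_iff[of g "total_degree g"] by blast
  then show "degree (Polynomial.monom (Poly_Mapping.lookup g m * monom_val m x) (mdeg m)) \<le> total_degree g"
    by (rule order_trans[OF degree_monom_le])
qed simp

text \<open>The polynomial functions of degree at most \<open>r\<close> are the combinations over the finite index set of
  exponents of degree at most \<open>r\<close>. Coefficient functions, unlike polynomials, carry a topology
  in which compactness arguments can be made.\<close>

definition combination :: "('n::finite \<Rightarrow>\<^sub>0 nat) set \<Rightarrow> (('n \<Rightarrow>\<^sub>0 nat) \<Rightarrow> real) \<Rightarrow> real ^ 'n \<Rightarrow> real" where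
  "combination M c x = (\<Sum>m\<in>M. c m * monom_val m x)"

text \<open>The bound on all rays says that every homogeneous part of degree above \<open>r\<close> vanishes at every
  point, so dropping these parts does not change the values of \<open>g\<close>.\<close>

lemma peval_eq_combination:
  assumes "\<And>x. degree (ray_poly g x) \<le> r"
  shows "peval g x = combination {m. mdeg m \<le> r} (Poly_Mapping.lookup g) x"
proof -
  let ?M = "{m \<in> Poly_Mapping.keys g. mdeg m \<le> r}"
  define low where "low = (\<Sum>m\<in>?M. Polynomial.monom (Poly_Mapping.lookup g m * monom_val m x) (mdeg m))"
  have "ray_poly g x = low"
  proof (rule poly_eqI)
    fix d
    show "coeff (ray_poly g x) d = coeff low d"
    proof (cases "d \<le> r")
      case True
      then show ?thesis
        unfolding ray_poly_def low_def coeff_sum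
        by (intro sum.mono_neutral_right) auto
    next
      case False
      then have "coeff low d = 0"
        unfolding low_def coeff_sum by (intro sum.neutral) auto
      with False assms[of x] show ?thesis
        by (simp add: coeff_eq_0)
    qed
  qed
  then have "peval g x = poly low 1"
    using poly_ray_poly[of g x 1] by simp
  also have "\<dots> = (\<Sum>m\<in>?M. Poly_Mapping.lookup g m * monom_val m x)"
    by (simp add: low_def poly_sum poly_monom)
  also have "\<dots> = combination {m. mdeg m \<le> r} (Poly_Mapping.lookup g) x"
    unfolding combination_def
    by (rule sum.mono_neutral_left) (auto simp: finite_mdeg_le in_keys_iff)
  finally show ?thesis .
qed

lemma peval_SOS_nonneg: "h \<in> SOS r \<Longrightarrow> peval h x \<ge> 0"
  by (auto simp: SOS_def peval_sum_list intro!: sum_list_nonneg)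

lemma member_le_sum_list_real:
  fixes f :: "'b \<Rightarrow> real"
  assumes "x \<in> set xs" "\<And>y. f y \<ge> 0"
  shows "f x \<le> (\<Sum>y\<leftarrow>xs. f y)"
  using assms(1)
proof (induction xs)
  case (Cons y ys)
  have "(\<Sum>y\<leftarrow>ys. f y) \<ge> 0"
    by (intro sum_list_nonneg) (use assms(2) in auto)
  with Cons assms(2)[of y] show ?case
    by (auto intro: add_increasing)
qed simp

text \<open>Top-degree terms of real squares cannot cancel: along every ray each square is dominated by the
  whole sum, so its root has degree at most \<open>r\<close>. Hence the optimization over all of \<open>SOS r\<close> takes
  place in a finite-dimensional space, although the squared polynomials are not bounded a priori.\<close>

lemma SOS_combinations:
  assumes "h \<in> SOS r"
  shows "\<exists>cs. \<forall>x. peval h x = (\<Sum>c\<leftarrow>cs. (combination {m. mdeg m \<le> r} c x)\<^sup>2)"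
proof -
  obtain gs where h: "h = (\<Sum>g\<leftarrow>gs. g ^ 2)" and deg: "total_degree h \<le> 2 * r"
    using assms by (auto simp: SOS_def)
  have eval: "peval h x = (\<Sum>g\<leftarrow>gs. (peval g x)\<^sup>2)" for x
    by (simp add: h peval_sum_list o_def)
  have "peval g x = combination {m. mdeg m \<le> r} (Poly_Mapping.lookup g) x" if g: "g \<in> set gs" for g x
  proof (rule peval_eq_combination)
    fix x
    show "degree (ray_poly g x) \<le> r"
    proof (rule degree_square_le)
      show "(poly (ray_poly g x) t)\<^sup>2 \<le> poly (ray_poly h x) t" for t
        unfolding poly_ray_poly eval
        by (rule member_le_sum_list_real[OF g, where f = "\<lambda>g. (peval g (t *\<^sub>R x))\<^sup>2"]) simp
      show "degree (ray_poly h x) \<le> 2 * r"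
        using degree_ray_poly deg by (rule order_trans)
    qed
  qed
  then have "peval h x = (\<Sum>c\<leftarrow>map Poly_Mapping.lookup gs. (combination {m. mdeg m \<le> r} c x)\<^sup>2)" for x
    unfolding eval by (simp add: o_def cong: map_cong)
  then show ?thesis
    by blast
qed

lemma square_in_SOS: "total_degree g \<le> r \<Longrightarrow> g ^ 2 \<in> SOS r"
  using total_degree_power_le[of g r 2] by (auto simp: SOS_def intro!: exI[of _ "[g]"])

lemma square_combination_in_SOS:
  "\<exists>h\<in>SOS r. \<forall>x. peval h x = (combination {m. mdeg m \<le> r} c x)\<^sup>2"
proof
  let ?g = "\<Sum>m\<in>{m. mdeg m \<le> r}. Poly_Mapping.single m (c m)"
  show "?g ^ 2 \<in> SOS r"
    by (intro square_in_SOS total_degree_sum_le total_degree_single_le) simp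
  show "\<forall>x. peval (?g ^ 2) x = (combination {m. mdeg m \<le> r} c x)\<^sup>2"
    by (simp add: peval_sum combination_def)
qed

section \<open>Attainment of a generalized Rayleigh quotient\<close>

text \<open>If \<open>B\<close> is definite on the coefficient vectors supported in \<open>I\<close>, the quotient \<open>A / B\<close> is continuous
  on the compact unit sphere and homogeneous of degree 0, so it attains its minimum. A nonzero null
  vector \<open>z\<close> of \<open>B\<close> can be used to clear one coordinate of any vector without changing \<open>A\<close> or \<open>B\<close>, which
  makes the index set smaller. The degenerate case does occur: polynomials may vanish almost
  everywhere, for instance on a sphere.\<close>

lemma quadratic_quotient_attains_min:
  fixes A B :: "('b \<Rightarrow> real) \<Rightarrow> real"
  assumes cont: "continuous_on UNIV A" "continuous_on UNIV B"
    and hom: "\<And>t c. A (\<lambda>i. t * c i) = t\<^sup>2 * A c" "\<And>t c. B (\<lambda>i. t * c i) = t\<^sup>2 * B c"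
    and nonneg: "\<And>c. B c \<ge> 0"
    and null: "\<And>z c. B z = 0 \<Longrightarrow> A (\<lambda>i. c i + z i) = A c" "\<And>z c. B z = 0 \<Longrightarrow> B (\<lambda>i. c i + z i) = B c"
    and "finite I" and supp: "\<And>i. i \<notin> I \<Longrightarrow> c1 i = 0" and pos: "B c1 > 0"
  shows "\<exists>c0. B c0 = 1 \<and> (\<forall>c. (\<forall>i. i \<notin> I \<longrightarrow> c i = 0) \<longrightarrow> A c0 * B c \<le> A c)"
  using \<open>finite I\<close> supp pos
proof (induction "card I" arbitrary: I c1 rule: less_induct)
  case less
  have scaled_zero: "A (\<lambda>i. 0) = 0" "B (\<lambda>i. 0) = 0"
    using hom[of 0] by simp_all
  show ?case
  proof (cases "\<exists>z. (\<forall>i. i \<notin> I \<longrightarrow> z i = 0) \<and> z \<noteq> (\<lambda>i. 0) \<and> B z = 0")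
    case True
    then obtain z k where z: "\<And>i. i \<notin> I \<Longrightarrow> z i = 0" "B z = 0" and k: "z k \<noteq> 0"
      by blast
    then have "k \<in> I"
      by blast
    \<comment> \<open>\<open>red\<close> subtracts the multiple of the null vector that clears coordinate \<open>k\<close>.\<close>
    define red where "red c = (\<lambda>i. c i + - (c k / z k) * z i)" for c
    have "B (\<lambda>i. - (c k / z k) * z i) = 0" for c
      by (simp only: hom z)
    then have red: "A (red c) = A c" "B (red c) = B c" for c
      unfolding red_def using null by blast+
    have supp_red: "red c i = 0" if "\<And>i. i \<notin> I \<Longrightarrow> c i = 0" "i \<notin> I - {k}" for c i
      using that k z by (cases "i = k") (auto simp: red_def)
    have "\<exists>c0. B c0 = 1 \<and> (\<forall>c. (\<forall>i. i \<notin> I - {k} \<longrightarrow> c i = 0) \<longrightarrow> A c0 * B c \<le> A c)"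
    proof (rule less.hyps)
      show "card (I - {k}) < card I"
        using \<open>k \<in> I\<close> less.prems by (intro psubset_card_mono) auto
      show "red c1 i = 0" if "i \<notin> I - {k}" for i
        using supp_red less.prems that by blast
    qed (use less.prems red in auto)
    then obtain c0 where c0: "B c0 = 1"
      "\<And>c. (\<forall>i. i \<notin> I - {k} \<longrightarrow> c i = 0) \<Longrightarrow> A c0 * B c \<le> A c"
      by blast
    have "A c0 * B c \<le> A c" if "\<forall>i. i \<notin> I \<longrightarrow> c i = 0" for c
      using c0(2)[of "red c"] supp_red[of c] that by (simp add: red)
    with c0(1) show ?thesis
      by blast
  next
    case False
    define N where "N c = (\<Sum>i\<in>I. (c i)\<^sup>2)" for c :: "'b \<Rightarrow> real"
    define S where "S = {c. (\<forall>i. i \<notin> I \<longrightarrow> c i = 0) \<and> N c = 1}"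
    have contN: "continuous_on UNIV N"
      unfolding N_def by (intro continuous_intros) auto
    have box: "compact (PiE UNIV (\<lambda>i. if i \<in> I then {-1..1} else {0::real}))"
      using compactin_PiE[of "\<lambda>_. euclidean" UNIV "\<lambda>i::'b. if i \<in> I then {-1..1} else {0::real}"]
      by (auto simp: euclidean_product_topology)
    have S_eq: "S = PiE UNIV (\<lambda>i. if i \<in> I then {-1..1} else {0}) \<inter> N -` {1}"
    proof -
      have "c i \<in> {-1..1}" if "i \<in> I" "N c = 1" for c i
      proof -
        have "(c i)\<^sup>2 \<le> N c"
          unfolding N_def by (rule member_le_sum) (use that less.prems in auto)
        then show ?thesis
          using that by (simp add: abs_square_le_1 abs_le_iff)
      qed
      then show ?thesis
        by (auto simp: S_def PiE_UNIV_domain split: if_splits)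
    qed
    have "closed (N -` {1})"
      using contN by (intro closed_vimage) auto
    with box have "compact S"
      unfolding S_eq by (rule compact_Int_closed)
    have pos: "B c > 0" if "c \<in> S" for c
    proof -
      have "c \<noteq> (\<lambda>i. 0)"
        using that by (auto simp: S_def N_def)
      then have "B c \<noteq> 0"
        using False that by (auto simp: S_def)
      with nonneg[of c] show ?thesis
        by simp
    qed
    have normalize: "\<exists>s>0. (\<lambda>i. s * c i) \<in> S" if c: "\<forall>i. i \<notin> I \<longrightarrow> c i = 0" "c \<noteq> (\<lambda>i. 0)" for c
    proof -
      obtain k where k: "c k \<noteq> 0"
        using c(2) by (auto simp: fun_eq_iff)
      then have "0 < N c"
        unfolding N_def using c less.prems by (intro sum_pos2[of I k]) auto
      then have "N (\<lambda>i. (1 / sqrt (N c)) * c i) = 1"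
        by (simp add: N_def power_mult_distrib power_divide flip: sum_divide_distrib sum_distrib_left)
      with c \<open>0 < N c\<close> show ?thesis
        by (intro exI[of _ "1 / sqrt (N c)"]) (auto simp: S_def)
    qed
    have "c1 \<noteq> (\<lambda>i. 0)"
      using less.prems scaled_zero by auto
    then have "S \<noteq> {}"
      using normalize[of c1] less.prems by blast
    have "continuous_on S (\<lambda>c. A c / B c)"
      using cont pos by (intro continuous_intros) (auto intro: continuous_on_subset simp: less_imp_neq[symmetric])
    with \<open>compact S\<close> \<open>S \<noteq> {}\<close> obtain c0 where c0: "c0 \<in> S" "\<And>c. c \<in> S \<Longrightarrow> A c0 / B c0 \<le> A c / B c"
      using continuous_attains_inf[of S "\<lambda>c. A c / B c"] by blast
    define d where "d = (\<lambda>i. (1 / sqrt (B c0)) * c0 i)"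
    have d: "B d = 1" "A d = A c0 / B c0"
      using pos[OF c0(1)] unfolding d_def hom by (simp_all add: power_divide)
    have "A d * B c \<le> A c" if c: "\<forall>i. i \<notin> I \<longrightarrow> c i = 0" for c
    proof (cases "c = (\<lambda>i. 0)")
      case True
      then show ?thesis
        by (simp add: scaled_zero)
    next
      case False
      then obtain s where s: "s > 0" "(\<lambda>i. s * c i) \<in> S"
        using normalize[OF c] by blast
      have "A d \<le> (s\<^sup>2 * A c) / (s\<^sup>2 * B c)"
        using c0(2)[OF s(2)] by (simp only: hom d)
      moreover have "B c > 0"
        using pos[OF s(2)] s(1) by (simp only: hom) (simp add: zero_less_mult_iff)
      ultimately show ?thesis
        using s(1) by (simp add: field_simps)
    qed
    with d(1) show ?thesis
      by blast
  qed
qed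

section \<open>Integration of polynomials over a compact set\<close>

lemma minimumI:
  assumes "v \<in> S" "\<And>w. w \<in> S \<Longrightarrow> v \<le> w"
  shows "minimum S = v"
  unfolding minimum_def using assms by (intro Least_equality)

locale finite_measure_on_compact = finite_measure \<mu>
  for K :: "(real ^ 'n::finite) set" and \<mu> :: "(real ^ 'n) measure" +
  assumes compact: "compact K" and sets_eq: "sets \<mu> = sets borel"
begin

abbreviation J :: "(real ^ 'n \<Rightarrow> real) \<Rightarrow> real" where
  "J F \<equiv> (LINT x:K|\<mu>. F x)"

lemma K_sets: "K \<in> sets \<mu>"
  using compact by (simp add: sets_eq compact_imp_closed)

lemma borel_measurable_eq: "borel_measurable \<mu> = (borel_measurable borel :: (real ^ 'n \<Rightarrow> real) set)"
  by (rule measurable_cong_sets) (simp_all add: sets_eq)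

lemma integrable_on_K:
  fixes F :: "real ^ 'n \<Rightarrow> real"
  assumes "continuous_on K F"
  shows "set_integrable \<mu> K F"
proof -
  have "bounded (F ` K)"
    using compact assms by (intro compact_imp_bounded compact_continuous_image)
  then obtain b where b: "\<And>x. x \<in> K \<Longrightarrow> \<bar>F x\<bar> \<le> b"
    by (auto simp: bounded_iff)
  show ?thesis
    unfolding set_integrable_def
  proof (rule integrable_const_bound)
    show "AE x in \<mu>. norm (indicator K x *\<^sub>R F x) \<le> max b 0"
      by (intro AE_I2) (auto simp: indicator_def dest: b)
    show "(\<lambda>x. indicator K x *\<^sub>R F x) \<in> borel_measurable \<mu>"
      unfolding borel_measurable_eq
      using assms compact by (intro borel_measurable_continuous_on_indicator) (auto intro: borel_closed compact_imp_closed)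
  qed
qed

lemma J_mono:
  assumes "continuous_on K F" "continuous_on K G" "\<And>x. x \<in> K \<Longrightarrow> F x \<le> G x"
  shows "J F \<le> J G"
  using assms by (intro set_integral_mono integrable_on_K)

lemma J_eq_0_imp_AE:
  assumes "continuous_on K F" "\<And>x. x \<in> K \<Longrightarrow> F x \<ge> 0" "J F = 0"
  shows "AE x in \<mu>. x \<in> K \<longrightarrow> F x = 0"
proof -
  have "AE x in \<mu>. indicator K x *\<^sub>R F x = 0"
    using integral_nonneg_eq_0_iff_AE[of \<mu> "\<lambda>x. indicator K x *\<^sub>R F x"] assms integrable_on_K[of F]
    by (auto simp: set_integrable_def set_lebesgue_integral_def indicator_def)
  then show ?thesis
    by eventually_elim auto
qed

lemma J_sum:
  assumes "\<And>i. i \<in> A \<Longrightarrow> continuous_on K (F i)"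
  shows "J (\<lambda>x. \<Sum>i\<in>A. F i x) = (\<Sum>i\<in>A. J (F i))"
  using assms
proof (induction A rule: infinite_finite_induct)
  case (insert a A)
  then show ?case
    by (simp add: integrable_on_K continuous_on_sum)
qed (simp_all add: set_lebesgue_integral_def)

lemma J_sum_list:
  assumes "\<And>i. continuous_on K (F i)"
  shows "J (\<lambda>x. \<Sum>i\<leftarrow>xs. F i x) = (\<Sum>i\<leftarrow>xs. J (F i)) \<and> continuous_on K (\<lambda>x. \<Sum>i\<leftarrow>xs. F i x)"
proof (induction xs)
  case (Cons a xs)
  then show ?case
    using assms by (simp add: integrable_on_K continuous_on_add)
qed (simp add: set_lebesgue_integral_def)

lemma J_pos:
  assumes "measure \<mu> K > 0" "continuous_on K F" "\<And>x. x \<in> K \<Longrightarrow> F x > 0"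
  shows "J F > 0"
proof -
  have "J (\<lambda>x. 0) \<le> J F"
    using assms by (intro J_mono) (auto intro: less_imp_le)
  then have nonneg: "J F \<ge> 0"
    by (simp add: set_lebesgue_integral_def)
  have "J F \<noteq> 0"
  proof
    assume "J F = 0"
    then have "AE x in \<mu>. x \<in> K \<longrightarrow> F x = 0"
      using assms by (intro J_eq_0_imp_AE) (auto intro: less_imp_le)
    then have "AE x in \<mu>. x \<notin> K"
      by eventually_elim (use assms(3) in force)
    then have "K \<in> null_sets \<mu>"
      using AE_iff_null_sets[OF K_sets] by blast
    with assms(1) show False
      by (auto simp: measure_def)
  qed
  with nonneg show ?thesis
    by simp
qed

subsection \<open>Attainment of the bounds\<close>

lemma continuous_combination: "continuous_on S (combination M c)"
  unfolding combination_def[abs_def] monom_val_def by (intro continuous_intros)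

lemma J_combination_square:
  assumes "finite M"
  shows "J (\<lambda>x. peval p x * (combination M c x)\<^sup>2) =
    (\<Sum>i\<in>M. \<Sum>j\<in>M. c i * c j * J (\<lambda>x. peval p x * (monom_val i x * monom_val j x)))"
proof -
  have "peval p x * (combination M c x)\<^sup>2 =
      (\<Sum>i\<in>M. \<Sum>j\<in>M. (c i * c j) * (peval p x * (monom_val i x * monom_val j x)))" for x
    by (simp add: combination_def power2_eq_square sum_product sum_distrib_left mult_ac)
  moreover have "continuous_on K (\<lambda>x. (c i * c j) * (peval p x * (monom_val i x * monom_val j x)))" for i j
    unfolding monom_val_def by (intro continuous_intros)
  ultimately show ?thesis
    by (simp add: J_sum continuous_on_sum)
qed

text \<open>By \<open>SOS_combinations\<close> the objective and the constraint are sums of \<open>Q p c\<close> and \<open>Q q c\<close> over the same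
  coefficient vectors, so a mediant argument shows that a single square minimizing \<open>Q p / Q q\<close> is
  optimal. Such a square exists because a null vector of \<open>Q q\<close> vanishes almost everywhere on \<open>K\<close>,
  where \<open>q\<close> is positive.\<close>

lemma rational_bound_attained:
  assumes q: "\<And>x. x \<in> K \<Longrightarrow> peval q x > 0" and "measure \<mu> K > 0"
  shows "\<exists>h\<in>SOS r. J (\<lambda>x. peval q x * peval h x) = 1 \<and>
    (\<forall>h'\<in>SOS r. J (\<lambda>x. peval q x * peval h' x) = 1 \<longrightarrow>
       J (\<lambda>x. peval p x * peval h x) \<le> J (\<lambda>x. peval p x * peval h' x))"
proof -
  define M where "M = {m :: 'n \<Rightarrow>\<^sub>0 nat. mdeg m \<le> r}"
  have M: "finite M" "0 \<in> M"
    by (simp_all add: M_def finite_mdeg_le)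
  define Q where "Q f c = J (\<lambda>x. peval f x * (combination M c x)\<^sup>2)" for f c
  have contQ: "continuous_on UNIV (Q f)" for f
    unfolding Q_def[abs_def] J_combination_square[OF M(1)] by (intro continuous_intros) auto
  have cont_integrand: "continuous_on K (\<lambda>x. peval f x * (combination M c x)\<^sup>2)" for f c
    by (intro continuous_intros continuous_combination)
  have homQ: "Q f (\<lambda>i. t * c i) = t\<^sup>2 * Q f c" for f t c
    by (simp add: Q_def combination_def power_mult_distrib mult.assoc mult.left_commute[of _ "t\<^sup>2"]
        flip: sum_distrib_left)
  have nonneg: "Q q c \<ge> 0" for c
  proof -
    have "J (\<lambda>x. 0) \<le> Q q c"
      unfolding Q_def by (intro J_mono cont_integrand) (auto intro!: mult_nonneg_nonneg less_imp_le[OF q])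
    then show ?thesis
      by (simp add: set_lebesgue_integral_def)
  qed
  have null: "Q f (\<lambda>i. c i + z i) = Q f c" if "Q q z = 0" for f c z
  proof -
    have "AE x in \<mu>. x \<in> K \<longrightarrow> peval q x * (combination M z x)\<^sup>2 = 0"
      using that unfolding Q_def
      by (intro J_eq_0_imp_AE cont_integrand) (auto intro!: mult_nonneg_nonneg less_imp_le[OF q])
    then have "AE x in \<mu>. x \<in> K \<longrightarrow> peval f x * (combination M (\<lambda>i. c i + z i) x)\<^sup>2 =
        peval f x * (combination M c x)\<^sup>2"
    proof eventually_elim
      case (elim x)
      show ?case
      proof
        assume "x \<in> K"
        with elim q[of x] have "combination M z x = 0"
          by auto
        then show "peval f x * (combination M (\<lambda>i. c i + z i) x)\<^sup>2 = peval f x * (combination M c x)\<^sup>2"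
          by (simp add: combination_def distrib_right sum.distrib)
      qed
    qed
    moreover have "(\<lambda>x. peval f x * (combination M c x)\<^sup>2) \<in> borel_measurable borel" for c
      by (intro borel_measurable_continuous_onI continuous_intros continuous_combination)
    ultimately show ?thesis
      unfolding Q_def by (intro set_lebesgue_integral_cong_AE)
        (auto simp: borel_measurable_eq sets_eq K_sets[unfolded sets_eq])
  qed
  \<comment> \<open>The constant polynomial 1, which shows that \<open>Q q\<close> is not identically zero.\<close>
  define c1 where "c1 = (\<lambda>m :: 'n \<Rightarrow>\<^sub>0 nat. if m = 0 then 1 else (0::real))"
  have comb1: "combination M c1 x = 1" for x
    using M by (simp add: combination_def c1_def if_distrib[of "\<lambda>t. t * _"] cong: if_cong)
  have pos: "Q q c1 > 0"
    unfolding Q_def comb1 using assms by (intro J_pos) (auto intro!: continuous_intros)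
  have "\<exists>c0. Q q c0 = 1 \<and> (\<forall>c. (\<forall>i. i \<notin> M \<longrightarrow> c i = 0) \<longrightarrow> Q p c0 * Q q c \<le> Q p c)"
  proof (rule quadratic_quotient_attains_min[where A = "Q p" and B = "Q q" and I = M and ?c1.0 = c1])
    show "Q p (\<lambda>i. c i + z i) = Q p c" "Q q (\<lambda>i. c i + z i) = Q q c" if "Q q z = 0" for z c
      by (rule null[OF that])+
    show "c1 i = 0" if "i \<notin> M" for i
      using that M by (auto simp: c1_def)
  qed (fact contQ homQ nonneg M pos)+
  then obtain c0 where c0: "Q q c0 = 1"
    "\<And>c. (\<forall>i. i \<notin> M \<longrightarrow> c i = 0) \<Longrightarrow> Q p c0 * Q q c \<le> Q p c"
    by blast
  have rayleigh: "Q p c0 * Q q c \<le> Q p c" for c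
  proof -
    have "combination M (\<lambda>i. if i \<in> M then c i else 0) = combination M c"
      by (auto simp: combination_def fun_eq_iff)
    then show ?thesis
      using c0(2)[of "\<lambda>i. if i \<in> M then c i else 0"] by (simp add: Q_def)
  qed
  obtain h where h: "h \<in> SOS r" "\<And>x. peval h x = (combination M c0 x)\<^sup>2"
    using square_combination_in_SOS[of r c0] unfolding M_def by blast
  have "Q p c0 \<le> J (\<lambda>x. peval p x * peval h' x)"
    if h': "h' \<in> SOS r" "J (\<lambda>x. peval q x * peval h' x) = 1" for h'
  proof -
    obtain cs where cs: "\<And>x. peval h' x = (\<Sum>c\<leftarrow>cs. (combination M c x)\<^sup>2)"
      using SOS_combinations[OF h'(1)] unfolding M_def by blast
    have eq: "J (\<lambda>x. peval f x * peval h' x) = (\<Sum>c\<leftarrow>cs. Q f c)" for f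
      unfolding cs sum_list_const_mult[symmetric] Q_def
      using J_sum_list[of "\<lambda>c x. peval f x * (combination M c x)\<^sup>2"] cont_integrand by blast
    have "Q p c0 = (\<Sum>c\<leftarrow>cs. Q p c0 * Q q c)"
      using h'(2) by (simp add: eq sum_list_const_mult)
    also have "\<dots> \<le> (\<Sum>c\<leftarrow>cs. Q p c)"
      by (intro sum_list_mono rayleigh)
    finally show ?thesis
      by (simp add: eq)
  qed
  moreover have "J (\<lambda>x. peval f x * peval h x) = Q f c0" for f
    by (simp add: h Q_def)
  ultimately show ?thesis
    using h(1) c0(1) by (intro bexI[of _ h]) simp_all
qed

lemma
  assumes "\<And>x. x \<in> K \<Longrightarrow> peval q x > 0" and "measure \<mu> K > 0"
  shows rational_upper_bound_attained: "\<exists>h\<in>SOS r. J (\<lambda>x. peval q x * peval h x) = 1 \<and>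
      J (\<lambda>x. peval p x * peval h x) = rational_upper_bound K \<mu> p q r"
    and rational_upper_bound_le: "h' \<in> SOS r \<Longrightarrow> J (\<lambda>x. peval q x * peval h' x) = 1 \<Longrightarrow>
      rational_upper_bound K \<mu> p q r \<le> J (\<lambda>x. peval p x * peval h' x)"
proof -
  obtain h where h: "h \<in> SOS r" "J (\<lambda>x. peval q x * peval h x) = 1"
    "\<And>h'. h' \<in> SOS r \<Longrightarrow> J (\<lambda>x. peval q x * peval h' x) = 1 \<Longrightarrow>
       J (\<lambda>x. peval p x * peval h x) \<le> J (\<lambda>x. peval p x * peval h' x)"
    using rational_bound_attained[OF assms, of r p] by blast
  then have eq: "rational_upper_bound K \<mu> p q r = J (\<lambda>x. peval p x * peval h x)"
    unfolding rational_upper_bound_def by (intro minimumI) auto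
  then show "\<exists>h\<in>SOS r. J (\<lambda>x. peval q x * peval h x) = 1 \<and>
      J (\<lambda>x. peval p x * peval h x) = rational_upper_bound K \<mu> p q r"
    using h(1,2) by auto
  show "rational_upper_bound K \<mu> p q r \<le> J (\<lambda>x. peval p x * peval h' x)"
    if "h' \<in> SOS r" "J (\<lambda>x. peval q x * peval h' x) = 1"
    using h(3)[OF that] eq by simp
qed

lemma polynomial_upper_bound_eq: "polynomial_upper_bound K \<mu> f r = rational_upper_bound K \<mu> f 1 r"
  by (simp add: polynomial_upper_bound_def rational_upper_bound_def mult.commute)

end

section \<open>From polynomial to rational objectives\<close>

lemma minimum_continuous_image:
  fixes F :: "'a::topological_space \<Rightarrow> real"
  assumes "compact K" "K \<noteq> {}" "continuous_on K F"
  obtains a where "a \<in> K" "minimum (F ` K) = F a" "\<And>x. x \<in> K \<Longrightarrow> F a \<le> F x"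
proof -
  obtain a where "a \<in> K" "\<And>x. x \<in> K \<Longrightarrow> F a \<le> F x"
    using continuous_attains_inf[OF assms] by blast
  moreover from this have "minimum (F ` K) = F a"
    by (intro minimumI) auto
  ultimately show thesis
    using that by blast
qed

context finite_measure_on_compact
begin

text \<open>Integrating \<open>v * q \<le> p\<close> against a nonnegative \<open>h\<close> with \<open>\<integral> q h = 1\<close>.\<close>

lemma value_le_rational_upper_bound:
  assumes q: "\<And>x. x \<in> K \<Longrightarrow> peval q x > 0" and "measure \<mu> K > 0"
    and v: "\<And>x. x \<in> K \<Longrightarrow> v * peval q x \<le> peval p x"
  shows "v \<le> rational_upper_bound K \<mu> p q r"
proof -
  obtain h where h: "h \<in> SOS r" "J (\<lambda>x. peval q x * peval h x) = 1"
    "J (\<lambda>x. peval p x * peval h x) = rational_upper_bound K \<mu> p q r"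
    using rational_upper_bound_attained[OF assms(1,2), of r p] by blast
  have "J (\<lambda>x. v * (peval q x * peval h x)) \<le> J (\<lambda>x. peval p x * peval h x)"
  proof (intro J_mono continuous_intros)
    show "v * (peval q x * peval h x) \<le> peval p x * peval h x" if "x \<in> K" for x
      using mult_right_mono[OF v[OF that] peval_SOS_nonneg[OF h(1), of x]] by (simp add: mult.assoc)
  qed
  with h show ?thesis
    by simp
qed

text \<open>The polynomial \<open>f = p - v * q\<close> is nonnegative on \<open>K\<close> with minimum 0. An optimal \<open>h\<close> for \<open>f\<close>, divided by
  \<open>c = \<integral> q h\<close>, is feasible for \<open>p / q\<close> and has value \<open>v + (\<integral> f h) / c\<close>. Since \<open>\<integral> h = 1\<close>, the divisor
  \<open>c\<close> is at least the minimum of \<open>q\<close> on \<open>K\<close>, which does not depend on \<open>r\<close>.\<close>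

lemma big_O_rational_upper_bound:
  assumes q: "\<And>x. x \<in> K \<Longrightarrow> peval q x > 0" and pos: "measure \<mu> K > 0" and "K \<noteq> {}"
    and v: "v = minimum ((\<lambda>x. peval p x / peval q x) ` K)"
    and rate: "big_O_pos (\<lambda>r. polynomial_upper_bound K \<mu> (p + const_rpoly (- v) * q) r
      - minimum (peval (p + const_rpoly (- v) * q) ` K)) \<epsilon>"
  shows "big_O_pos (\<lambda>r. rational_upper_bound K \<mu> p q r - v) \<epsilon>"
proof -
  define f where "f = p + const_rpoly (- v) * q"
  have f: "peval f x = peval p x - v * peval q x" for x
    by (simp add: f_def)
  have cont_ratio: "continuous_on K (\<lambda>x. peval p x / peval q x)"
    by (intro continuous_intros) (use q in force)
  obtain a where a: "a \<in> K" "v = peval p a / peval q a"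
    "\<And>x. x \<in> K \<Longrightarrow> peval p a / peval q a \<le> peval p x / peval q x"
    by (rule minimum_continuous_image[OF compact \<open>K \<noteq> {}\<close> cont_ratio]) (simp add: v)
  have v_le: "v * peval q x \<le> peval p x" if "x \<in> K" for x
    using a(2) a(3)[OF that] q[OF that] by (simp add: field_simps)
  have "peval f a = 0"
    using a(2) q[OF a(1)] by (simp add: f)
  then have "minimum (peval f ` K) = 0"
    using a(1) v_le by (intro minimumI) (auto simp: f intro: rev_image_eqI)
  then obtain C where C: "\<And>r. r \<ge> 1 \<Longrightarrow> \<bar>polynomial_upper_bound K \<mu> f r\<bar> \<le> C * \<bar>\<epsilon> r\<bar>"
    using rate by (auto simp: big_O_pos_def f_def)
  have cont: "continuous_on K (peval q)"
    by (intro continuous_intros)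
  obtain b where b: "b \<in> K" "\<And>x. x \<in> K \<Longrightarrow> peval q b \<le> peval q x"
    using continuous_attains_inf[OF compact \<open>K \<noteq> {}\<close> cont] by blast
  define \<beta> where "\<beta> = peval q b"
  have \<beta>: "\<beta> > 0"
    using q b by (simp add: \<beta>_def)
  have "\<bar>rational_upper_bound K \<mu> p q r - v\<bar> \<le> (C / \<beta>) * \<bar>\<epsilon> r\<bar>" if r: "r \<ge> 1" for r
  proof -
    have one: "\<And>x. x \<in> K \<Longrightarrow> peval 1 x > 0"
      by simp
    obtain h where h: "h \<in> SOS r" "J (\<lambda>x. peval 1 x * peval h x) = 1"
      "J (\<lambda>x. peval f x * peval h x) = rational_upper_bound K \<mu> f 1 r"
      using rational_upper_bound_attained[OF one pos, of r f] by blast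
    have fh: "J (\<lambda>x. peval f x * peval h x) = polynomial_upper_bound K \<mu> f r"
      using h(3) by (simp add: polynomial_upper_bound_eq)
    define c where "c = J (\<lambda>x. peval q x * peval h x)"
    have "J (\<lambda>x. \<beta> * peval h x) \<le> c"
      unfolding c_def \<beta>_def using peval_SOS_nonneg[OF h(1)] b
      by (intro J_mono continuous_intros mult_right_mono) auto
    then have c: "c \<ge> \<beta>"
      using h(2) by simp
    obtain gs where gs: "h = (\<Sum>g\<leftarrow>gs. g ^ 2)" and deg: "total_degree h \<le> 2 * r"
      using h(1) by (auto simp: SOS_def)
    define h' where "h' = const_rpoly (1 / c) * h"
    have "h' \<in> SOS r"
    proof -
      have "(const_rpoly (1 / sqrt c) * g)\<^sup>2 = const_rpoly (1 / c) * g\<^sup>2" for g :: "'n rpoly"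
      proof -
        have "(const_rpoly (1 / sqrt c))\<^sup>2 = (const_rpoly (1 / c) :: 'n rpoly)"
          using c \<beta> by (simp add: power2_eq_square mult_single)
        then show ?thesis
          by (simp add: power_mult_distrib)
      qed
      then have "h' = (\<Sum>g\<leftarrow>map (\<lambda>g. const_rpoly (1 / sqrt c) * g) gs. g ^ 2)"
        by (simp add: h'_def gs o_def sum_list_const_mult)
      moreover have "total_degree h' \<le> 2 * r"
        using total_degree_mult_le[OF total_degree_single_le[of 0 0] deg] by (simp add: h'_def)
      ultimately show ?thesis
        unfolding SOS_def by blast
    qed
    have scaled: "J (\<lambda>x. peval g x * peval h' x) = J (\<lambda>x. peval g x * peval h x) / c" for g
    proof -
      have "peval g x * peval h' x = (1 / c) * (peval g x * peval h x)" for x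
        by (simp add: h'_def)
      then show ?thesis
        by (simp only: set_integral_mult_right) simp
    qed
    have feasible: "J (\<lambda>x. peval q x * peval h' x) = 1"
      using c \<beta> by (simp add: scaled flip: c_def)
    have upper: "rational_upper_bound K \<mu> p q r \<le> J (\<lambda>x. peval p x * peval h' x)"
      using q pos \<open>h' \<in> SOS r\<close> feasible by (rule rational_upper_bound_le)
    have "J (\<lambda>x. peval p x * peval h x) = J (\<lambda>x. peval f x * peval h x + v * (peval q x * peval h x))"
      by (simp add: f algebra_simps)
    also have "\<dots> = polynomial_upper_bound K \<mu> f r + v * c"
      unfolding c_def fh[symmetric]
      by (subst set_integral_add) (auto intro!: integrable_on_K continuous_intros)
    finally have "rational_upper_bound K \<mu> p q r - v \<le> polynomial_upper_bound K \<mu> f r / c"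
      using upper c \<beta> unfolding scaled by (simp add: add_divide_distrib)
    also have "\<dots> \<le> (C * \<bar>\<epsilon> r\<bar>) / c"
      using C[OF r] c \<beta> by (intro divide_right_mono) auto
    also have "\<dots> \<le> (C * \<bar>\<epsilon> r\<bar>) / \<beta>"
    proof (rule divide_left_mono)
      show "0 \<le> C * \<bar>\<epsilon> r\<bar>"
        using C[OF r] by linarith
    qed (use c \<beta> in auto)
    finally show ?thesis
      using value_le_rational_upper_bound[OF q pos v_le, of r] by simp
  qed
  then show ?thesis
    unfolding big_O_pos_def by blast
qed

text \<open>For a null measure no \<open>h\<close> is feasible, so every bound is the same unspecified number \<open>minimum {}\<close>.
  The rates would force it to equal the minimum of every constant polynomial.\<close>

lemma measure_pos_of_polynomial_rates:
  assumes "K \<noteq> {}" "\<epsilon> \<longlonglongrightarrow> 0"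
    and rate: "\<And>f. big_O_pos (\<lambda>r. polynomial_upper_bound K \<mu> f r - minimum (peval f ` K)) \<epsilon>"
  shows "measure \<mu> K > 0"
proof (rule ccontr)
  assume "\<not> measure \<mu> K > 0"
  then have "measure \<mu> K = 0"
    using measure_nonneg[of \<mu> K] by simp
  then have "K \<in> null_sets \<mu>"
    using K_sets by (auto simp: null_sets_def emeasure_eq_measure)
  then have null: "J F = 0" for F
    unfolding set_lebesgue_integral_def
    by (intro integral_eq_zero_AE) (auto dest!: AE_not_in elim!: eventually_mono)
  have const: "polynomial_upper_bound K \<mu> f r = minimum {}" for f r
    by (simp add: polynomial_upper_bound_def null)
  have "minimum {} = c" for c
  proof -
    have "minimum (peval (const_rpoly c) ` K) = c"
      using \<open>K \<noteq> {}\<close> by (intro minimumI) auto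
    then obtain C where C: "\<And>r. r \<ge> 1 \<Longrightarrow> \<bar>minimum {} - c\<bar> \<le> C * \<bar>\<epsilon> r\<bar>"
      using rate[of "const_rpoly c"] by (auto simp: big_O_pos_def const)
    have "(\<lambda>r. C * \<bar>\<epsilon> r\<bar>) \<longlonglongrightarrow> C * \<bar>0\<bar>"
      by (intro tendsto_intros assms)
    then have "\<bar>minimum {} - c\<bar> \<le> C * \<bar>0\<bar>"
      by (rule LIMSEQ_le_const) (use C in blast)
    then show ?thesis
      by simp
  qed
  from this[of 0] this[of 1] show False
    by simp
qed

end

section \<open>Fejer kernels\<close>

text \<open>This is \<open>k\<close> times the Fejer kernel as a polynomial in the cosine: \<open>fejer k\<close> at \<open>cos \<theta>\<close> is
  \<open>(1 - cos (k * \<theta>)) / (1 - cos \<theta>)\<close> when \<open>cos \<theta> \<noteq> 1\<close>. The recursion for \<open>cos (k * \<theta>)\<close> survives the division by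
  \<open>1 - cos \<theta>\<close>, which shows that the quotient is a polynomial of degree at most \<open>k - 1\<close>.\<close>

fun fejer :: "nat \<Rightarrow> real poly" where
  "fejer 0 = 0"
| "fejer (Suc 0) = 1"
| "fejer (Suc (Suc k)) = [:0, 2:] * fejer (Suc k) - fejer k + [:2:]"

lemma degree_fejer: "degree (fejer k) \<le> k - 1"
proof (induction k rule: fejer.induct)
  case (3 k)
  have "degree ([:0, 2:] * fejer (Suc k)) \<le> Suc k"
    using degree_mult_le[of "[:0, 2:]" "fejer (Suc k)"] 3 by simp
  moreover have "degree (fejer k) \<le> Suc k"
    using 3 by simp
  ultimately show ?case
    by (simp del: mult_pCons_left add: degree_add_le degree_diff_le)
qed simp_all

lemma fejer_cos: "poly (fejer k) (cos \<theta>) * (1 - cos \<theta>) = 1 - cos (real k * \<theta>)"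
proof (induction k rule: fejer.induct)
  case (3 k)
  have "cos (real (Suc (Suc k)) * \<theta>) = cos (real (Suc k) * \<theta> + \<theta>)"
    "cos (real k * \<theta>) = cos (real (Suc k) * \<theta> - \<theta>)"
    by (simp_all add: algebra_simps)
  then have rec: "cos (real (Suc (Suc k)) * \<theta>) = 2 * cos \<theta> * cos (real (Suc k) * \<theta>) - cos (real k * \<theta>)"
    unfolding cos_add cos_diff by simp
  have "poly (fejer (Suc (Suc k))) (cos \<theta>) * (1 - cos \<theta>) =
      2 * cos \<theta> * (poly (fejer (Suc k)) (cos \<theta>) * (1 - cos \<theta>))
      - poly (fejer k) (cos \<theta>) * (1 - cos \<theta>) + 2 * (1 - cos \<theta>)"
    by (simp add: algebra_simps)
  also have "\<dots> = 1 - cos (real (Suc (Suc k)) * \<theta>)"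
    unfolding 3 rec by (simp add: algebra_simps)
  finally show ?case .
qed simp_all

lemma fejer_at_1: "poly (fejer k) 1 = (real k)\<^sup>2"
  by (induction k rule: fejer.induct) (simp_all add: power2_eq_square algebra_simps)

context
  fixes t :: real
  assumes t: "-1 \<le> t" "t \<le> 1"
begin

lemma fejer_weighted_bounds: "0 \<le> poly (fejer k) t * (1 - t)" "poly (fejer k) t * (1 - t) \<le> 2"
  using fejer_cos[of k "arccos t"] t by (simp_all add: cos_arccos)

lemma fejer_nonneg: "poly (fejer k) t \<ge> 0"
proof (cases "t = 1")
  case False
  with t have "t < 1"
    by simp
  then show ?thesis
    using fejer_weighted_bounds(1)[of k] by (simp add: zero_le_mult_iff)
qed (simp add: fejer_at_1)

text \<open>The product on the right lies between 0 and 2. Summing twice therefore bounds the kernel by \<open>k\<^sup>2\<close>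
  everywhere, and then from below by \<open>k\<^sup>2 / 2\<close> as long as \<open>1 - t\<close> is at most \<open>1 / (2 * k\<^sup>2)\<close>.\<close>

lemma fejer_second_difference:
  "poly (fejer (Suc (Suc k))) t - poly (fejer (Suc k)) t =
   poly (fejer (Suc k)) t - poly (fejer k) t + 2 - 2 * (poly (fejer (Suc k)) t * (1 - t))"
  by (simp add: algebra_simps)

lemma fejer_upper: "poly (fejer k) t \<le> (real k)\<^sup>2"
proof -
  have "poly (fejer (Suc k)) t - poly (fejer k) t \<le> 2 * real k + 1 \<and> poly (fejer k) t \<le> (real k)\<^sup>2" for k
  proof (induction k)
    case (Suc k)
    then have "poly (fejer (Suc k)) t \<le> (real (Suc k))\<^sup>2"
      by (simp add: power2_eq_square algebra_simps)
    moreover have "poly (fejer (Suc (Suc k))) t - poly (fejer (Suc k)) t \<le> 2 * real (Suc k) + 1"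
      using Suc fejer_weighted_bounds(1)[of "Suc k"] unfolding fejer_second_difference by simp
    ultimately show ?case
      by blast
  qed simp
  then show ?thesis
    by blast
qed

lemma fejer_lower:
  assumes "2 * (real k)\<^sup>2 * (1 - t) \<le> 1"
  shows "poly (fejer k) t \<ge> (real k)\<^sup>2 / 2"
proof -
  have "poly (fejer (Suc j)) t - poly (fejer j) t \<ge> real j + 1 \<and> poly (fejer j) t \<ge> (real j)\<^sup>2 / 2"
    if "j \<le> k" for j
    using that
  proof (induction j)
    case (Suc j)
    then have IH: "poly (fejer (Suc j)) t - poly (fejer j) t \<ge> real j + 1" "poly (fejer j) t \<ge> (real j)\<^sup>2 / 2"
      by auto
    then have "poly (fejer (Suc j)) t \<ge> (real (Suc j))\<^sup>2 / 2"
      by (simp add: power2_eq_square field_simps)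
    moreover have "2 * (poly (fejer (Suc j)) t * (1 - t)) \<le> 1"
    proof -
      have "(real (Suc j))\<^sup>2 \<le> (real k)\<^sup>2"
        using Suc.prems by (intro power_mono) auto
      with fejer_upper[of "Suc j"] have "poly (fejer (Suc j)) t \<le> (real k)\<^sup>2"
        by linarith
      then have "poly (fejer (Suc j)) t * (1 - t) \<le> (real k)\<^sup>2 * (1 - t)"
        using t by (intro mult_right_mono) auto
      with assms show ?thesis
        by simp
    qed
    ultimately show ?case
      using IH unfolding fejer_second_difference by simp
  qed simp
  then show ?thesis
    by blast
qed

end

section \<open>Concentration under a doubling condition\<close>

definition linear_rpoly :: "real ^ 'n::finite \<Rightarrow> 'n rpoly" where
  "linear_rpoly a = (\<Sum>i\<in>UNIV. Poly_Mapping.single (Poly_Mapping.single i 1) (a $ i))"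

definition compose_rpoly :: "real poly \<Rightarrow> 'n::finite rpoly \<Rightarrow> 'n rpoly" where
  "compose_rpoly P l = (\<Sum>j\<le>degree P. const_rpoly (coeff P j) * l ^ j)"

lemma peval_linear_rpoly: "peval (linear_rpoly a) x = a \<bullet> x"
proof -
  have "monom_val (Poly_Mapping.single i 1) x = x $ i" for i
    by (simp add: monom_val_def lookup_single when_def if_distrib[of "\<lambda>k. _ ^ k"] cong: if_cong)
  then show ?thesis
    by (simp add: linear_rpoly_def peval_sum inner_vec_def)
qed

lemma total_degree_linear_rpoly: "total_degree (linear_rpoly a) \<le> 1"
  unfolding linear_rpoly_def
  by (intro total_degree_sum_le total_degree_single_le) (simp add: mdeg_def lookup_single when_def)

lemma peval_compose_rpoly: "peval (compose_rpoly P l) x = poly P (peval l x)"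
  by (simp add: compose_rpoly_def peval_sum poly_altdef)

lemma total_degree_compose_rpoly:
  assumes "total_degree l \<le> 1"
  shows "total_degree (compose_rpoly P l) \<le> degree P"
  unfolding compose_rpoly_def
proof (rule total_degree_sum_le)
  fix j assume "j \<in> {..degree P}"
  moreover have "total_degree (const_rpoly (coeff P j) * l ^ j) \<le> 0 + j * 1"
    by (intro total_degree_mult_le total_degree_single_le total_degree_power_le assms) simp
  ultimately show "total_degree (const_rpoly (coeff P j) * l ^ j) \<le> degree P"
    by simp
qed

context finite_measure_on_compact
begin

lemma J_indicator:
  assumes "A \<in> sets \<mu>" "A \<subseteq> K"
  shows "set_integrable \<mu> K (indicator A :: real ^ 'n \<Rightarrow> real)" "J (indicator A) = measure \<mu> A"
proof -
  have eq: "(\<lambda>x. indicator K x *\<^sub>R indicator A x :: real) = indicator A"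
    using assms(2) by (auto simp: fun_eq_iff indicator_def)
  show "set_integrable \<mu> K (indicator A :: real ^ 'n \<Rightarrow> real)"
    unfolding set_integrable_def eq using assms(1) by (simp add: less_top[symmetric])
  show "J (indicator A) = measure \<mu> A"
    unfolding set_lebesgue_integral_def eq using assms(1) by (simp add: sets.Int_space_eq1)
qed

text \<open>The integral of \<open>F ^ (2 * m) * u\<close> is split at the levels \<open>u = 4 ^ j / (2 * k\<^sup>2)\<close>. Between two levels
  the decay of \<open>F\<close> gives, up to a constant, a factor \<open>(4 / 16 ^ m) ^ j / k\<^sup>2\<close>, while doubling lets the measure of the level
  set grow by at most \<open>D ^ j\<close>; the choice of \<open>m\<close> makes the sum geometric. The innermost level set,
  on which \<open>F\<close> is at least \<open>1 / 2\<close>, bounds the integral of \<open>F ^ (2 * m)\<close> from below.\<close>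

lemma doubling_concentration:
  fixes u F :: "real ^ 'n \<Rightarrow> real"
  assumes cont: "continuous_on K u" "continuous_on K F"
    and u: "\<And>x. x \<in> K \<Longrightarrow> 0 \<le> u x" "\<And>x. x \<in> K \<Longrightarrow> u x \<le> 2"
    and doubling: "\<And>\<delta>. \<delta> > 0 \<Longrightarrow> measure \<mu> {x\<in>K. u x \<le> 4 * \<delta>} \<le> D * measure \<mu> {x\<in>K. u x \<le> \<delta>}"
    and D: "D \<ge> 0" "4 * D / 16 ^ m \<le> 1 / 2"
    and k: "k \<ge> 1" and pos: "measure \<mu> K > 0"
    and F: "\<And>x. x \<in> K \<Longrightarrow> 0 \<le> F x" "\<And>x. x \<in> K \<Longrightarrow> F x \<le> 1"
      "\<And>x. x \<in> K \<Longrightarrow> (real k)\<^sup>2 * (F x * u x) \<le> 2"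
      "\<And>x. x \<in> K \<Longrightarrow> 2 * (real k)\<^sup>2 * u x \<le> 1 \<Longrightarrow> F x \<ge> 1 / 2"
  shows "J (\<lambda>x. F x ^ (2 * m)) > 0"
    and "J (\<lambda>x. F x ^ (2 * m) * u x) \<le> 1024 ^ m / (real k)\<^sup>2 * J (\<lambda>x. F x ^ (2 * m))"
proof -
  define \<delta> where "\<delta> j = 4 ^ j / (2 * (real k)\<^sup>2)" for j :: nat
  define A where "A j = {x\<in>K. u x \<le> \<delta> j}" for j
  define V where "V j = measure \<mu> (A j)" for j
  have k2: "(real k)\<^sup>2 > 0"
    using k by simp
  have \<delta>_pos: "\<delta> j > 0" for j
    using k2 by (simp add: \<delta>_def)
  have A_sets: "A j \<in> sets \<mu>" for j
  proof -
    have "closed (A j)"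
      unfolding A_def using cont(1) compact_imp_closed[OF compact]
      by (intro continuous_on_closed_Collect_le) (auto intro: continuous_intros)
    then show ?thesis
      by (simp add: sets_eq)
  qed
  have A_sub: "A j \<subseteq> K" for j
    by (auto simp: A_def)
  note ind = J_indicator[OF A_sets A_sub]
  have V_step: "V (Suc j) \<le> D * V j" for j
    using doubling[OF \<delta>_pos[of j]] by (simp add: V_def A_def \<delta>_def)
  have V_pow: "V j \<le> D ^ j * V 0" for j
  proof (induction j)
    case (Suc j)
    have "V (Suc j) \<le> D * (D ^ j * V 0)"
      using V_step[of j] mult_left_mono[OF Suc D(1)] by linarith
    then show ?case
      by (simp add: mult.assoc)
  qed simp
  obtain J0 where J0: "4 * (real k)\<^sup>2 < 4 ^ J0"
    using real_arch_pow[of 4 "4 * (real k)\<^sup>2"] by auto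
  then have "\<delta> J0 \<ge> 2"
    using k2 by (simp add: \<delta>_def field_simps)
  then have "A J0 = K"
    using u(2) by (fastforce simp: A_def)
  then have "V 0 > 0"
    using V_pow[of J0] pos D(1) by (auto simp: V_def zero_less_mult_iff dest: order_less_le_trans)
  have cont_pow: "continuous_on K (\<lambda>x. F x ^ (2 * m))"
    by (intro continuous_intros cont)
  have "J (\<lambda>x. (1 / 4 ^ m) * indicator (A 0) x) \<le> J (\<lambda>x. F x ^ (2 * m))"
  proof (rule set_integral_mono)
    show "set_integrable \<mu> K (\<lambda>x. (1 / 4 ^ m) * indicator (A 0) x :: real)"
      using ind(1) by (intro set_integrable_mult_right)
    show "set_integrable \<mu> K (\<lambda>x. F x ^ (2 * m))"
      using cont_pow by (rule integrable_on_K)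
    fix x assume x: "x \<in> K"
    show "(1 / 4 ^ m) * indicator (A 0) x \<le> F x ^ (2 * m)"
    proof (cases "x \<in> A 0")
      case True
      then have "2 * (real k)\<^sup>2 * u x \<le> 1"
        using k2 by (simp add: A_def \<delta>_def field_simps)
      then have "(1 / 2) ^ (2 * m) \<le> F x ^ (2 * m)"
        using F(4)[OF x] by (intro power_mono) auto
      with True show ?thesis
        by (simp add: power_mult power_divide)
    qed (use F(1)[OF x] in simp)
  qed
  then have lower: "V 0 \<le> 4 ^ m * J (\<lambda>x. F x ^ (2 * m))"
    by (simp add: ind(2) V_def field_simps)
  with \<open>V 0 > 0\<close> have "0 < 4 ^ m * J (\<lambda>x. F x ^ (2 * m))"
    by linarith
  then show "J (\<lambda>x. F x ^ (2 * m)) > 0"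
    by (simp add: zero_less_mult_iff)
  define B where "B = 256 ^ m / (2 * (real k)\<^sup>2)"
  have B: "B > 0"
    using k2 by (simp add: B_def)
  have "J (\<lambda>x. F x ^ (2 * m) * u x) \<le> J (\<lambda>x. \<Sum>j\<le>J0. (B * (4 / 16 ^ m) ^ j) * indicator (A j) x)"
  proof (intro set_integral_mono)
    show "set_integrable \<mu> K (\<lambda>x. F x ^ (2 * m) * u x)"
      by (intro integrable_on_K continuous_intros cont)
    show "set_integrable \<mu> K (\<lambda>x. \<Sum>j\<le>J0. (B * (4 / 16 ^ m) ^ j) * indicator (A j) x)"
      unfolding set_integrable_def scaleR_sum_right
      by (intro Bochner_Integration.integrable_sum)
        (use set_integrable_mult_right[OF ind(1)] in \<open>simp add: set_integrable_def\<close>)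
    fix x assume x: "x \<in> K"
    \<comment> \<open>The innermost level set containing \<open>x\<close>; its term alone already dominates the left-hand side.\<close>
    define i where "i = (LEAST j. x \<in> A j)"
    have ex: "x \<in> A J0"
      using x \<open>A J0 = K\<close> by simp
    then have i: "x \<in> A i" "i \<le> J0"
      unfolding i_def by (rule LeastI, rule Least_le)
    have "F x ^ (2 * m) * u x \<le> B * (4 / 16 ^ m) ^ i"
    proof (cases i)
      case 0
      have "F x ^ (2 * m) * u x \<le> 1 * \<delta> 0"
        using F(1,2)[OF x] u(1)[OF x] i(1) 0 by (intro mult_mono power_le_one) (auto simp: A_def)
      also have "\<dots> \<le> B"
        using k2 by (simp add: \<delta>_def B_def divide_simps)
      finally show ?thesis
        using 0 by simp
    next
      case (Suc l)
      then have "x \<notin> A l"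
        using not_less_Least[of l "\<lambda>j. x \<in> A j"] by (simp add: i_def)
      then have ul: "u x > \<delta> l"
        using x by (simp add: A_def)
      then have u0: "u x > 0"
        using \<delta>_pos[of l] by linarith
      have "(real k)\<^sup>2 * (F x * \<delta> l) \<le> (real k)\<^sup>2 * (F x * u x)"
        using ul F(1)[OF x] by (intro mult_left_mono) auto
      with F(3)[OF x] have "(real k)\<^sup>2 * (F x * \<delta> l) \<le> 2"
        by linarith
      then have "F x \<le> 16 / 4 ^ i"
        using k2 by (simp add: \<delta>_def Suc field_simps)
      then have "F x ^ (2 * m) \<le> (16 / 4 ^ i) ^ (2 * m)"
        using F(1)[OF x] by (intro power_mono)
      also have "\<dots> = 256 ^ m / (16 ^ m) ^ i"
      proof -
        have "(16 / 4 ^ i :: real)\<^sup>2 = 256 / 16 ^ i"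
          by (simp add: power2_eq_square flip: power_mult_distrib)
        then have "(16 / 4 ^ i :: real) ^ (2 * m) = (256 / 16 ^ i) ^ m"
          by (simp only: power_mult)
        also have "\<dots> = 256 ^ m / (16 ^ m) ^ i"
          by (simp add: power_divide mult.commute flip: power_mult)
        finally show ?thesis .
      qed
      finally have "F x ^ (2 * m) * u x \<le> 256 ^ m / (16 ^ m) ^ i * \<delta> i"
        using u(1)[OF x] i(1) by (intro mult_mono) (auto simp: A_def)
      also have "\<dots> = B * (4 / 16 ^ m) ^ i"
        by (simp add: \<delta>_def B_def power_divide)
      finally show ?thesis .
    qed
    also have "\<dots> = (B * (4 / 16 ^ m) ^ i) * indicator (A i) x"
      using i by simp
    also have "\<dots> \<le> (\<Sum>j\<le>J0. (B * (4 / 16 ^ m) ^ j) * indicator (A j) x)"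
      using i B by (intro member_le_sum[of i _ "\<lambda>j. (B * (4 / 16 ^ m) ^ j) * indicator (A j) x"])
        (auto intro!: mult_nonneg_nonneg)
    finally show "F x ^ (2 * m) * u x \<le> (\<Sum>j\<le>J0. (B * (4 / 16 ^ m) ^ j) * indicator (A j) x)" .
  qed
  also have "\<dots> = (\<Sum>j\<le>J0. (B * (4 / 16 ^ m) ^ j) * V j)"
  proof -
    have "J (\<lambda>x. \<Sum>j\<le>J0. (B * (4 / 16 ^ m) ^ j) * indicator (A j) x)
        = (\<Sum>j\<le>J0. J (\<lambda>x. (B * (4 / 16 ^ m) ^ j) * indicator (A j) x))"
      unfolding set_lebesgue_integral_def scaleR_sum_right
      by (intro Bochner_Integration.integral_sum)
        (use set_integrable_mult_right[OF ind(1)] in \<open>simp add: set_integrable_def\<close>)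
    then show ?thesis
      by (simp add: ind(2) V_def)
  qed
  also have "\<dots> \<le> (\<Sum>j\<le>J0. B * V 0 * (1 / 2) ^ j)"
  proof (rule sum_mono)
    fix j
    have "(B * (4 / 16 ^ m) ^ j) * V j \<le> (B * (4 / 16 ^ m) ^ j) * (D ^ j * V 0)"
      using B by (intro mult_left_mono V_pow) auto
    also have "\<dots> = B * V 0 * (4 * D / 16 ^ m) ^ j"
      by (simp add: power_divide power_mult_distrib)
    also have "\<dots> \<le> B * V 0 * (1 / 2) ^ j"
      using B \<open>V 0 > 0\<close> D by (intro mult_left_mono power_mono) auto
    finally show "(B * (4 / 16 ^ m) ^ j) * V j \<le> B * V 0 * (1 / 2) ^ j" .
  qed
  also have "\<dots> \<le> B * V 0 * 2"
  proof -
    have "(\<Sum>j\<le>J0. (1 / 2) ^ j) \<le> (2 :: real)"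
    proof -
      have "(1 - 1 / 2) * (\<Sum>j\<le>J0. (1 / 2) ^ j) \<le> (1 :: real)"
        unfolding sum_gp_basic by simp
      then show ?thesis
        by simp
    qed
    then show ?thesis
      using B \<open>V 0 > 0\<close> by (simp flip: sum_distrib_left)
  qed
  also have "\<dots> = 256 ^ m / (real k)\<^sup>2 * V 0"
    using k2 by (simp add: B_def)
  also have "\<dots> \<le> 256 ^ m / (real k)\<^sup>2 * (4 ^ m * J (\<lambda>x. F x ^ (2 * m)))"
    using lower by (intro mult_left_mono) auto
  also have "\<dots> = 1024 ^ m / (real k)\<^sup>2 * J (\<lambda>x. F x ^ (2 * m))"
    by (simp flip: power_mult_distrib)
  finally show "J (\<lambda>x. F x ^ (2 * m) * u x) \<le> 1024 ^ m / (real k)\<^sup>2 * J (\<lambda>x. F x ^ (2 * m))" .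
qed

text \<open>The test density is a multiple of \<open>F ^ (2 * m)\<close>, where \<open>F\<close> is \<open>fejer k\<close> in \<open>a \<bullet> x\<close> divided by \<open>k\<^sup>2\<close> and
  the exponent \<open>m\<close> depends only on the doubling constant. Degree \<open>r\<close> for the root leaves room for
  \<open>k = r div m + 1\<close>, so \<open>1 / k\<^sup>2\<close> and \<open>1 / r\<^sup>2\<close> are comparable.\<close>

lemma big_O_polynomial_upper_bound:
  fixes a :: "real ^ 'n"
  defines "u \<equiv> \<lambda>x. 1 - a \<bullet> x"
  assumes a: "a \<in> K" "\<And>x. x \<in> K \<Longrightarrow> peval f a \<le> peval f x"
    and u: "\<And>x. x \<in> K \<Longrightarrow> 0 \<le> u x" "\<And>x. x \<in> K \<Longrightarrow> u x \<le> 2"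
    and growth: "\<And>x. x \<in> K \<Longrightarrow> peval f x - peval f a \<le> C * u x" and "C \<ge> 0"
    and doubling: "\<And>\<delta>. \<delta> > 0 \<Longrightarrow> measure \<mu> {x\<in>K. u x \<le> 4 * \<delta>} \<le> D * measure \<mu> {x\<in>K. u x \<le> \<delta>}"
    and "D \<ge> 0" and pos: "measure \<mu> K > 0"
  shows "big_O_pos (\<lambda>r. polynomial_upper_bound K \<mu> f r - peval f a) (\<lambda>r. 1 / (real r)\<^sup>2)"
proof -
  obtain m0 where "8 * D < 16 ^ m0"
    using real_arch_pow[of 16 "8 * D"] by auto
  also have "(16 :: real) ^ m0 \<le> 16 ^ Suc m0"
    by (intro power_increasing) auto
  finally obtain m where m: "8 * D \<le> 16 ^ m" "m \<ge> 1"
    by (metis less_imp_le le_add1 plus_1_eq_Suc)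
  have "\<bar>polynomial_upper_bound K \<mu> f r - peval f a\<bar> \<le> (C * (1024 ^ m * (real m)\<^sup>2)) * \<bar>1 / (real r)\<^sup>2\<bar>"
    if r: "r \<ge> 1" for r
  proof -
    define k where "k = Suc (r div m)"
    define P where "P = smult (1 / (real k)\<^sup>2) (fejer k)"
    define S where "S = compose_rpoly P (linear_rpoly a)"
    define F where "F = peval S"
    have k2: "(real k)\<^sup>2 > 0"
      by (simp add: k_def)
    have F_eq: "F x = poly (fejer k) (1 - u x) / (real k)\<^sup>2" for x
      by (simp add: F_def S_def P_def peval_compose_rpoly peval_linear_rpoly u_def)
    have t: "-1 \<le> 1 - u x" "1 - u x \<le> 1" if "x \<in> K" for x
      using u[OF that] by simp_all
    have cont: "continuous_on K u" "continuous_on K F"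
      unfolding u_def F_def by (intro continuous_intros)+
    have "4 * D / 16 ^ m \<le> 1 / 2"
      using m(1) by (simp add: field_simps)
    moreover have "0 \<le> F x" "F x \<le> 1" "(real k)\<^sup>2 * (F x * u x) \<le> 2"
        "2 * (real k)\<^sup>2 * u x \<le> 1 \<Longrightarrow> F x \<ge> 1 / 2" if "x \<in> K" for x
      using fejer_nonneg[OF t[OF that], of k] fejer_upper[OF t[OF that], of k]
        fejer_weighted_bounds(2)[OF t[OF that], of k] fejer_lower[OF t[OF that], of k] k2
      by (simp_all add: F_eq field_simps)
    ultimately have c_pos: "J (\<lambda>x. F x ^ (2 * m)) > 0"
      and conc: "J (\<lambda>x. F x ^ (2 * m) * u x) \<le> 1024 ^ m / (real k)\<^sup>2 * J (\<lambda>x. F x ^ (2 * m))"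
      using doubling_concentration[OF cont u doubling \<open>D \<ge> 0\<close> _ _ pos, where m = m and k = k] by (simp_all add: k_def)
    define c where "c = J (\<lambda>x. F x ^ (2 * m))"
    define h where "h = (const_rpoly (1 / sqrt c) * S ^ m) ^ 2"
    have h: "peval h x = (1 / c) * F x ^ (2 * m)" for x
      using c_pos by (simp add: h_def F_def power_mult_distrib power_divide c_def power_mult[of _ m 2] mult.commute[of 2 m])
    have "total_degree S \<le> k - 1"
      unfolding S_def using total_degree_compose_rpoly[OF total_degree_linear_rpoly, of P a] degree_fejer[of k]
      unfolding P_def by (meson degree_smult_le order_trans)
    then have "total_degree (const_rpoly (1 / sqrt c) * S ^ m) \<le> 0 + m * (k - 1)"
      by (intro total_degree_mult_le total_degree_single_le total_degree_power_le) simp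
    also have "\<dots> \<le> r"
      by (simp add: k_def)
    finally have "h \<in> SOS r"
      unfolding h_def by (rule square_in_SOS)
    have c: "c > 0"
      using c_pos by (simp add: c_def)
    have J_h: "J (peval h) = 1"
      unfolding h[abs_def] using c_pos by (simp add: c_def)
    have one: "\<And>x. x \<in> K \<Longrightarrow> peval 1 x > 0"
      by simp
    have "polynomial_upper_bound K \<mu> f r \<le> J (\<lambda>x. peval f x * peval h x)"
      unfolding polynomial_upper_bound_eq
      using J_h by (intro rational_upper_bound_le[OF one pos \<open>h \<in> SOS r\<close>]) simp_all
    also have "\<dots> \<le> J (\<lambda>x. peval f a * peval h x + (C / c) * (F x ^ (2 * m) * u x))"
    proof (intro J_mono continuous_intros cont)
      fix x assume x: "x \<in> K"
      have "peval f x * peval h x \<le> (peval f a + C * u x) * peval h x"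
        using growth[OF x] peval_SOS_nonneg[OF \<open>h \<in> SOS r\<close>, of x] by (intro mult_right_mono) auto
      then show "peval f x * peval h x \<le> peval f a * peval h x + (C / c) * (F x ^ (2 * m) * u x)"
        by (simp add: h algebra_simps add_divide_distrib)
    qed
    also have "\<dots> = peval f a + (C / c) * J (\<lambda>x. F x ^ (2 * m) * u x)"
      using c by (subst set_integral_add) (auto intro!: integrable_on_K continuous_intros cont simp: J_h)
    finally have "polynomial_upper_bound K \<mu> f r - peval f a \<le> (C / c) * J (\<lambda>x. F x ^ (2 * m) * u x)"
      by simp
    also have "\<dots> \<le> (C / c) * (1024 ^ m / (real k)\<^sup>2 * c)"
      using conc c_pos \<open>C \<ge> 0\<close> by (intro mult_left_mono) (auto simp: c_def)
    also have "\<dots> = C * 1024 ^ m * (1 / (real k)\<^sup>2)"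
      using c_pos by (simp add: c_def)
    also have "\<dots> \<le> C * 1024 ^ m * ((real m)\<^sup>2 / (real r)\<^sup>2)"
    proof (intro mult_left_mono)
      have "r < k * m"
        unfolding k_def using m(2) dividend_less_div_times[of m r] by (simp add: mult.commute)
      then have "real r \<le> real k * real m"
        by (metis less_imp_le of_nat_le_iff of_nat_mult)
      then have "(real r)\<^sup>2 \<le> (real k)\<^sup>2 * (real m)\<^sup>2"
        using power_mono[of "real r" "real k * real m" 2] by (simp add: power_mult_distrib)
      then show "1 / (real k)\<^sup>2 \<le> (real m)\<^sup>2 / (real r)\<^sup>2"
        using k2 r by (simp add: field_simps)
    qed (use \<open>C \<ge> 0\<close> in simp)
    finally have "polynomial_upper_bound K \<mu> f r - peval f a \<le> (C * (1024 ^ m * (real m)\<^sup>2)) * \<bar>1 / (real r)\<^sup>2\<bar>"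
      by simp
    moreover have "peval f a \<le> polynomial_upper_bound K \<mu> f r"
      unfolding polynomial_upper_bound_eq
      by (intro value_le_rational_upper_bound[OF one pos]) (use a(2) in auto)
    ultimately show ?thesis
      by simp
  qed
  then show ?thesis
    unfolding big_O_pos_def by blast
qed

end

section \<open>Growth at a minimizer on the sphere\<close>

text \<open>A first-order Taylor expansion at \<open>a\<close> with quadratic remainder, uniform on \<open>S\<close>. The class of such
  functions is closed under sums and, for bounded \<open>S\<close>, under products, so it then contains all
  polynomial functions.\<close>

definition first_order_at :: "'a::real_inner \<Rightarrow> 'a set \<Rightarrow> ('a \<Rightarrow> real) \<Rightarrow> bool" where
  "first_order_at a S F \<longleftrightarrow>
     (\<exists>g C. C \<ge> 0 \<and> (\<forall>x\<in>S. \<bar>F x - F a - g \<bullet> (x - a)\<bar> \<le> C * (norm (x - a))\<^sup>2))"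

lemma first_order_const: "first_order_at a S (\<lambda>x. c)"
  unfolding first_order_at_def by (intro exI[of _ 0]) simp

lemma first_order_inner: "first_order_at a S (\<lambda>x. b \<bullet> x)"
  unfolding first_order_at_def by (intro exI[of _ b] exI[of _ 0]) (simp add: inner_diff_right)

lemma first_order_add:
  assumes "first_order_at a S F" "first_order_at a S G"
  shows "first_order_at a S (\<lambda>x. F x + G x)"
proof -
  obtain g C where "C \<ge> 0"
    and F: "\<And>x. x \<in> S \<Longrightarrow> \<bar>F x - F a - g \<bullet> (x - a)\<bar> \<le> C * (norm (x - a))\<^sup>2"
    using assms(1) by (auto simp: first_order_at_def)
  obtain h D where "D \<ge> 0"
    and G: "\<And>x. x \<in> S \<Longrightarrow> \<bar>G x - G a - h \<bullet> (x - a)\<bar> \<le> D * (norm (x - a))\<^sup>2"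
    using assms(2) by (auto simp: first_order_at_def)
  have "\<bar>F x + G x - (F a + G a) - (g + h) \<bullet> (x - a)\<bar> \<le> (C + D) * (norm (x - a))\<^sup>2" if "x \<in> S" for x
    using F[OF that] G[OF that] by (simp add: inner_add_left distrib_right)
  with \<open>C \<ge> 0\<close> \<open>D \<ge> 0\<close> show ?thesis
    unfolding first_order_at_def by (intro exI[of _ "g + h"] exI[of _ "C + D"]) auto
qed

lemma first_order_mult:
  assumes "bounded S" "first_order_at a S F" "first_order_at a S G"
  shows "first_order_at a S (\<lambda>x. F x * G x)"
proof -
  obtain g C where "C \<ge> 0"
    and F: "\<And>x. x \<in> S \<Longrightarrow> \<bar>F x - F a - g \<bullet> (x - a)\<bar> \<le> C * (norm (x - a))\<^sup>2"
    using assms(2) by (auto simp: first_order_at_def)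
  moreover obtain h D where "D \<ge> 0"
    and G: "\<And>x. x \<in> S \<Longrightarrow> \<bar>G x - G a - h \<bullet> (x - a)\<bar> \<le> D * (norm (x - a))\<^sup>2"
    using assms(3) by (auto simp: first_order_at_def)
  ultimately have CD: "C \<ge> 0" "D \<ge> 0"
    by simp_all
  obtain R where R: "R \<ge> 0" "\<And>x. x \<in> S \<Longrightarrow> norm (x - a) \<le> R"
    using bounded_translation_minus[OF assms(1), of a] by (auto simp: bounded_pos intro: less_imp_le)
  have lip: "\<bar>H x - H a\<bar> \<le> (norm l + E * R) * norm (x - a)"
    if "\<bar>H x - H a - l \<bullet> (x - a)\<bar> \<le> E * (norm (x - a))\<^sup>2" "E \<ge> 0" "x \<in> S" for H l E x
  proof -
    have "E * (norm (x - a))\<^sup>2 \<le> E * R * norm (x - a)"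
      unfolding power2_eq_square mult.assoc using R(2)[OF that(3)] that(2)
      by (intro mult_left_mono mult_right_mono) auto
    with that(1) Cauchy_Schwarz_ineq2[of l "x - a"] show ?thesis
      by (simp add: distrib_right)
  qed
  let ?E = "(norm g + C * R) * (norm h + D * R) + \<bar>F a\<bar> * D + \<bar>G a\<bar> * C"
  have "\<bar>F x * G x - F a * G a - (F a *\<^sub>R h + G a *\<^sub>R g) \<bullet> (x - a)\<bar> \<le> ?E * (norm (x - a))\<^sup>2"
    if x: "x \<in> S" for x
  proof -
    have "F x * G x - F a * G a - (F a *\<^sub>R h + G a *\<^sub>R g) \<bullet> (x - a) =
        (F x - F a) * (G x - G a) + F a * (G x - G a - h \<bullet> (x - a)) + G a * (F x - F a - g \<bullet> (x - a))"
      by (simp add: inner_add_left algebra_simps)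
    moreover have "\<bar>(F x - F a) * (G x - G a)\<bar> \<le>
        ((norm g + C * R) * norm (x - a)) * ((norm h + D * R) * norm (x - a))"
      unfolding abs_mult using lip[OF F[OF x]] lip[OF G[OF x]] x CD R(1) by (intro mult_mono) auto
    moreover have "\<bar>F a * (G x - G a - h \<bullet> (x - a))\<bar> \<le> \<bar>F a\<bar> * (D * (norm (x - a))\<^sup>2)"
      unfolding abs_mult by (intro mult_left_mono G x) auto
    moreover have "\<bar>G a * (F x - F a - g \<bullet> (x - a))\<bar> \<le> \<bar>G a\<bar> * (C * (norm (x - a))\<^sup>2)"
      unfolding abs_mult by (intro mult_left_mono F x) auto
    ultimately have "\<bar>F x * G x - F a * G a - (F a *\<^sub>R h + G a *\<^sub>R g) \<bullet> (x - a)\<bar> \<le>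
        ((norm g + C * R) * norm (x - a)) * ((norm h + D * R) * norm (x - a))
        + \<bar>F a\<bar> * (D * (norm (x - a))\<^sup>2) + \<bar>G a\<bar> * (C * (norm (x - a))\<^sup>2)"
      by linarith
    also have "\<dots> = ?E * (norm (x - a))\<^sup>2"
      by (simp add: power2_eq_square algebra_simps)
    finally show ?thesis .
  qed
  moreover have "?E \<ge> 0"
    using CD R(1) by simp
  ultimately show ?thesis
    unfolding first_order_at_def by blast
qed

lemma first_order_peval:
  assumes "bounded S"
  shows "first_order_at a S (peval f)"
proof -
  have power: "first_order_at a S (\<lambda>x. F x ^ k)" if "first_order_at a S F" for F k
    by (induction k) (simp_all add: first_order_const first_order_mult assms that)
  have coord: "first_order_at a S (\<lambda>x. x $ i)" for i
    using first_order_inner[of a S "axis i 1"] by (simp add: inner_axis')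
  have prod: "first_order_at a S (\<lambda>x. \<Prod>i\<in>I. F i x)" if "finite I" "\<And>i. first_order_at a S (F i)" for I F
    using that(1) by (induction I) (simp_all add: first_order_const first_order_mult assms that(2))
  have sum: "first_order_at a S (\<lambda>x. \<Sum>i\<in>I. F i x)" if "finite I" "\<And>i. first_order_at a S (F i)" for I F
    using that(1) by (induction I) (simp_all add: first_order_const first_order_add that(2))
  show ?thesis
    unfolding peval_def[abs_def]
    by (intro sum first_order_mult first_order_const prod power coord assms) auto
qed

lemma norm_diff_unit_vectors:
  fixes x a :: "'a::real_inner"
  assumes "norm x = 1" "norm a = 1"
  shows "(norm (x - a))\<^sup>2 = 2 * (1 - a \<bullet> x)"
  using assms by (simp add: power2_norm_eq_inner inner_diff inner_commute norm_eq_1)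

text \<open>Reflecting \<open>x\<close> in the axis of \<open>a\<close> gives a point \<open>y\<close> of the sphere with \<open>f y \<ge> f a\<close>. Hence
  \<open>f x - f a \<le> (f x - f a) + (f y - f a)\<close>, and on the right the gradient only acts on
  \<open>(x - a) + (y - a)\<close>, which is itself of second order. This replaces the optimality condition that the
  tangential gradient vanishes at \<open>a\<close>.\<close>

lemma quadratic_growth_on_sphere:
  fixes a :: "real ^ 'n::finite"
  assumes a: "norm a = 1" "\<And>x. norm x = 1 \<Longrightarrow> peval f a \<le> peval f x"
  obtains C where "C \<ge> 0" "\<And>x. norm x = 1 \<Longrightarrow> peval f x - peval f a \<le> C * (1 - a \<bullet> x)"
proof -
  have "first_order_at a (sphere 0 1) (peval f)"
    by (intro first_order_peval bounded_sphere)
  then obtain g C where C: "C \<ge> 0"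
    and "\<forall>x\<in>sphere 0 1. \<bar>peval f x - peval f a - g \<bullet> (x - a)\<bar> \<le> C * (norm (x - a))\<^sup>2"
    unfolding first_order_at_def by blast
  then have exp: "\<bar>peval f x - peval f a - g \<bullet> (x - a)\<bar> \<le> C * (norm (x - a))\<^sup>2" if "norm x = 1" for x
    using that by simp
  have "peval f x - peval f a \<le> (4 * C + 2 * norm g) * (1 - a \<bullet> x)" if x: "norm x = 1" for x
  proof -
    define u where "u = 1 - a \<bullet> x"
    define y where "y = (2 * (a \<bullet> x)) *\<^sub>R a - x"
    have aa: "a \<bullet> a = 1" "x \<bullet> x = 1"
      using a(1) x by (simp_all add: norm_eq_1)
    have "y \<bullet> y = 1"
      by (simp add: y_def inner_diff aa inner_commute algebra_simps)
    then have y: "norm y = 1"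
      by (simp add: norm_eq_1)
    have "a \<bullet> y = a \<bullet> x"
      by (simp add: y_def inner_diff aa)
    then have dist: "(norm (x - a))\<^sup>2 = 2 * u" "(norm (y - a))\<^sup>2 = 2 * u"
      using norm_diff_unit_vectors[OF x a(1)] norm_diff_unit_vectors[OF y a(1)] by (simp_all add: u_def)
    then have "u \<ge> 0"
      by (metis zero_le_mult_iff zero_le_power2 not_numeral_le_zero)
    have "(x - a) + (y - a) = (- 2 * u) *\<^sub>R a"
      by (simp add: y_def u_def algebra_simps scaleR_2)
    then have "g \<bullet> (x - a) + g \<bullet> (y - a) = - 2 * u * (g \<bullet> a)"
      by (metis inner_add_right inner_scaleR_right)
    also have "\<dots> \<le> 2 * norm g * u"
      using mult_left_mono[of "- (g \<bullet> a)" "norm g" "2 * u"] Cauchy_Schwarz_ineq2[of g a] a(1) \<open>u \<ge> 0\<close>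
      by (simp add: algebra_simps)
    finally have "g \<bullet> (x - a) + g \<bullet> (y - a) \<le> 2 * norm g * u" .
    moreover have "peval f a \<le> peval f y"
      using a(2) y by blast
    ultimately show ?thesis
      using exp[OF x] exp[OF y] unfolding dist by (simp add: u_def[symmetric] distrib_right)
  qed
  moreover have "4 * C + 2 * norm g \<ge> 0"
    using C by simp
  ultimately show thesis
    using that by blast
qed

section \<open>Doubling of spherical caps\<close>

text \<open>The part of the punctured unit ball over the cap \<open>1 - a \<bullet> x \<le> \<delta>\<close> of the unit sphere, whose Lebesgue
  measure is proportional to the surface measure of the cap.\<close>

definition cone_in_ball :: "real ^ 'n::finite \<Rightarrow> real \<Rightarrow> (real ^ 'n) set" where
  "cone_in_ball a \<delta> = {y. norm y < 1 \<and> y \<noteq> 0 \<and> norm y - a \<bullet> y \<le> \<delta> * norm y}"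

lemma cone_in_ball_measurable [measurable]: "cone_in_ball a \<delta> \<in> sets borel"
  unfolding cone_in_ball_def by measurable

text \<open>The contraction towards \<open>a\<close> with ratio \<open>1 / 64\<close> divides the distance from the axis by 64 and does
  not decrease the height \<open>a \<bullet> y\<close>. For narrow cones this reduces \<open>norm y - a \<bullet> y\<close>, which is quadratic in
  the distance from the axis, by much more than the required factor 4. For wide cones it suffices that
  the image of the whole ball is concentrated near \<open>a\<close>.\<close>

lemma homothety_maps_cone:
  fixes a y :: "real ^ 'n::finite"
  assumes a: "norm a = 1" and \<delta>: "\<delta> > 0" and y: "y \<in> cone_in_ball a (4 * \<delta>)"
  shows "(1 / 64) *\<^sub>R y + (63 / 64) *\<^sub>R a \<in> cone_in_ball a \<delta>"
proof -
  define z where "z = (1 / 64) *\<^sub>R y + (63 / 64) *\<^sub>R a"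
  define t where "t = a \<bullet> y"
  define s where "s = a \<bullet> z"
  have aa: "a \<bullet> a = 1"
    using a by (simp add: norm_eq_1)
  have y1: "norm y < 1" "y \<noteq> 0" and cone: "norm y - t \<le> 4 * \<delta> * norm y"
    using y by (auto simp: cone_in_ball_def t_def)
  have t_le: "\<bar>t\<bar> \<le> norm y"
    using Cauchy_Schwarz_ineq2[of a y] a by (simp add: t_def)
  have s: "s = t / 64 + 63 / 64"
    by (simp add: s_def z_def t_def inner_add_right aa)
  have s_ge: "s \<ge> 62 / 64" "s \<ge> t"
    using t_le y1 by (simp_all add: s)
  have s_le: "s \<le> norm z"
    using Cauchy_Schwarz_ineq2[of a z] a by (simp add: s_def)
  have "norm z \<le> norm ((1 / 64) *\<^sub>R y) + norm ((63 / 64) *\<^sub>R a)"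
    unfolding z_def by (rule norm_triangle_ineq)
  then have z1: "norm z < 1"
    using y1 a by simp
  have "z \<noteq> 0"
    using s_ge s_le by auto
  have "(norm z)\<^sup>2 - s\<^sup>2 = ((norm y)\<^sup>2 - t\<^sup>2) / 4096"
    unfolding power2_norm_eq_inner s
    by (simp add: z_def inner_add inner_commute aa t_def power2_eq_square field_simps)
  then have prod: "(norm z - s) * (norm z + s) = (norm y - t) * (norm y + t) / 4096"
    by (simp add: power2_eq_square algebra_simps)
  have "norm z - s \<le> \<delta> * norm z"
  proof (cases "\<delta> \<le> 1 / 8")
    case True
    then have "4 * \<delta> * norm y \<le> 1 / 2 * norm y"
      by (intro mult_right_mono) auto
    then have "t \<ge> norm y / 2"
      using cone by simp
    then have sum: "norm y \<le> norm z + s"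
      using s_ge s_le by simp
    have "(norm z - s) * norm y \<le> (norm z - s) * (norm z + s)"
      using s_le sum by (intro mult_left_mono) auto
    also have "\<dots> \<le> (4 * \<delta> * norm y) * (2 * norm y) / 4096"
      unfolding prod using cone t_le \<delta> by (intro divide_right_mono mult_mono) auto
    also have "\<dots> = (\<delta> * norm y / 512) * norm y"
      by simp
    finally have "norm z - s \<le> \<delta> * norm y / 512"
      using y1 by simp
    also have "\<dots> \<le> \<delta> * norm z"
    proof -
      have "norm y \<le> 512 * norm z"
        using sum s_le norm_ge_zero[of z] by linarith
      with \<delta> show ?thesis
        by (simp add: mult.commute)
    qed
    finally show ?thesis .
  next
    case False
    have "(norm y - t) * (norm y + t) \<le> 2 * 2"
      using t_le y1 by (intro mult_mono) auto
    have "(norm z - s) * (62 / 64) \<le> (norm z - s) * (norm z + s)"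
      using s_ge s_le by (intro mult_left_mono) auto
    also have "\<dots> \<le> 4 / 4096"
      unfolding prod using \<open>(norm y - t) * (norm y + t) \<le> 2 * 2\<close> by simp
    finally have "norm z - s \<le> 1 / 8 * (62 / 64)"
      by simp
    also have "\<dots> \<le> \<delta> * norm z"
      using False s_ge s_le by (intro mult_mono) auto
    finally show ?thesis .
  qed
  with z1 \<open>z \<noteq> 0\<close> show ?thesis
    by (simp add: cone_in_ball_def z_def[symmetric] s_def)
qed

text \<open>The wider cone lies in the image of the narrower one under the inverse homothety, and this
  multiplies Lebesgue measure by a constant that does not depend on \<open>\<delta>\<close>.\<close>

lemma emeasure_cone_doubling:
  fixes a :: "real ^ 'n::finite"
  assumes "norm a = 1" "\<delta> > 0"
  shows "emeasure lborel (cone_in_ball a (4 * \<delta>)) \<le> 64 ^ CARD('n) * emeasure lborel (cone_in_ball a \<delta>)"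
proof -
  let ?T = "\<lambda>z. 64 *\<^sub>R z + (- 63) *\<^sub>R a"
  let ?S = "\<lambda>y. (1 / 64) *\<^sub>R y + (63 / 64) *\<^sub>R a"
  have image: "?T ` cone_in_ball a \<delta> = ?S -` cone_in_ball a \<delta>"
  proof
    show "?T ` cone_in_ball a \<delta> \<subseteq> ?S -` cone_in_ball a \<delta>"
      by (auto simp: scaleR_diff_right)
    show "?S -` cone_in_ball a \<delta> \<subseteq> ?T ` cone_in_ball a \<delta>"
    proof
      fix y assume "y \<in> ?S -` cone_in_ball a \<delta>"
      then show "y \<in> ?T ` cone_in_ball a \<delta>"
        by (intro rev_image_eqI[of "?S y"]) (auto simp: scaleR_add_right)
    qed
  qed
  have "cone_in_ball a (4 * \<delta>) \<subseteq> ?T ` cone_in_ball a \<delta>"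
    unfolding image using homothety_maps_cone[OF assms] by blast
  moreover have "?T ` cone_in_ball a \<delta> \<in> sets lebesgue"
  proof -
    have "?S \<in> borel_measurable borel"
      by measurable
    from measurable_sets[OF this cone_in_ball_measurable] show ?thesis
      unfolding image by simp
  qed
  ultimately have "emeasure lebesgue (cone_in_ball a (4 * \<delta>)) \<le> emeasure lebesgue (?T ` cone_in_ball a \<delta>)"
    by (rule emeasure_mono)
  also have "\<dots> = 64 ^ CARD('n) * emeasure lebesgue (cone_in_ball a \<delta>)"
    unfolding emeasure_lebesgue_affine by (simp flip: ennreal_power)
  finally show ?thesis
    by simp
qed

lemma emeasure_sphere_surface_measure:
  fixes A :: "(real ^ 'n::finite) set"
  assumes "A \<in> sets borel"
  shows "emeasure sphere_surface_measure A =
    of_nat CARD('n) * emeasure lborel {y. norm y < 1 \<and> y \<noteq> 0 \<and> y /\<^sub>R norm y \<in> A}"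
proof -
  let ?U = "ball 0 1 - {0} :: (real ^ 'n) set"
  have meas: "(\<lambda>x. x /\<^sub>R norm x) \<in> restrict_space lborel ?U \<rightarrow>\<^sub>M borel"
    by (intro measurable_restrict_space1) measurable
  have "emeasure (distr (restrict_space lborel ?U) borel (\<lambda>x. x /\<^sub>R norm x)) A =
      emeasure (restrict_space lborel ?U) ((\<lambda>x. x /\<^sub>R norm x) -` A \<inter> ?U)"
    using meas assms by (subst emeasure_distr) (simp_all add: space_restrict_space)
  also have "\<dots> = emeasure lborel ((\<lambda>x. x /\<^sub>R norm x) -` A \<inter> ?U)"
    by (intro emeasure_restrict_space) auto
  also have "(\<lambda>x. x /\<^sub>R norm x) -` A \<inter> ?U = {y. norm y < 1 \<and> y \<noteq> 0 \<and> y /\<^sub>R norm y \<in> A}"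
    by auto
  finally show ?thesis
    by (simp add: sphere_surface_measure_def)
qed

lemma emeasure_cap:
  fixes a :: "real ^ 'n::finite"
  shows "emeasure sphere_surface_measure {x \<in> sphere 0 1. 1 - a \<bullet> x \<le> \<delta>} =
    of_nat CARD('n) * emeasure lborel (cone_in_ball a \<delta>)"
proof -
  have "{x \<in> sphere 0 1. 1 - a \<bullet> x \<le> \<delta>} \<in> sets borel"
    by measurable
  moreover have "{y. norm y < 1 \<and> y \<noteq> 0 \<and> y /\<^sub>R norm y \<in> {x \<in> sphere 0 1. 1 - a \<bullet> x \<le> \<delta>}} = cone_in_ball a \<delta>"
    by (auto simp: cone_in_ball_def field_simps)
  ultimately show ?thesis
    by (simp only: emeasure_sphere_surface_measure)
qed

lemma measure_cap_doubling:
  fixes a :: "real ^ 'n::finite"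
  assumes "finite_measure (sphere_surface_measure :: (real ^ 'n) measure)" "norm a = 1" "\<delta> > 0"
  shows "measure sphere_surface_measure {x \<in> sphere 0 1. 1 - a \<bullet> x \<le> 4 * \<delta>} \<le>
    64 ^ CARD('n) * measure sphere_surface_measure {x \<in> sphere 0 1. 1 - a \<bullet> x \<le> \<delta>}"
proof -
  interpret finite_measure "sphere_surface_measure :: (real ^ 'n) measure"
    by (rule assms(1))
  have "emeasure sphere_surface_measure {x \<in> sphere 0 1. 1 - a \<bullet> x \<le> 4 * \<delta>} \<le>
      64 ^ CARD('n) * emeasure sphere_surface_measure {x \<in> sphere 0 1. 1 - a \<bullet> x \<le> \<delta>}"
    unfolding emeasure_cap using mult_left_mono[OF emeasure_cone_doubling[OF assms(2,3)], of "of_nat CARD('n)"]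
    by (simp add: mult_ac)
  moreover have "(64 :: ennreal) ^ CARD('n) = ennreal (64 ^ CARD('n))"
    by (simp flip: ennreal_power)
  ultimately show ?thesis
    by (simp add: emeasure_eq_measure ennreal_mult[symmetric])
qed

lemma measure_sphere_pos:
  assumes "finite_measure (sphere_surface_measure :: (real ^ 'n::finite) measure)"
  shows "measure (sphere_surface_measure :: (real ^ 'n) measure) (sphere 0 1) > 0"
proof -
  interpret finite_measure "sphere_surface_measure :: (real ^ 'n) measure"
    by (rule assms(1))
  have "(1 / 2) *\<^sub>R (axis undefined 1 :: real ^ 'n) \<in> ball 0 1 - {0}"
    by (simp add: axis_eq_0_iff)
  moreover have "open (ball 0 1 - {0} :: (real ^ 'n) set)"
    by (intro open_delete open_ball)
  ultimately have "\<not> negligible (ball 0 1 - {0} :: (real ^ 'n) set)"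
    by (metis empty_iff open_not_negligible)
  then have "emeasure lborel (ball 0 1 - {0} :: (real ^ 'n) set) \<noteq> 0"
    by (subst (asm) negligible_iff_emeasure0) auto
  moreover have "{y :: real ^ 'n. norm y < 1 \<and> y \<noteq> 0 \<and> y /\<^sub>R norm y \<in> sphere 0 1} = ball 0 1 - {0}"
    by auto
  ultimately have "emeasure (sphere_surface_measure :: (real ^ 'n) measure) (sphere 0 1) \<noteq> 0"
    by (simp add: emeasure_sphere_surface_measure)
  then show ?thesis
    by (simp add: emeasure_eq_measure zero_less_measure_iff)
qed

section \<open>The convergence rates\<close>

theorem theorem10:
  fixes K :: "(real ^ 'n::finite) set" and \<mu> :: "(real ^ 'n) measure" and p q :: "'n rpoly"
  assumes "compact K" and "K \<noteq> {}"
    and "finite_measure \<mu>" and "sets \<mu> = sets borel" and "emeasure \<mu> (- K) = 0"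
    and "\<forall>x\<in>K. peval q x > 0"
  defines "val \<equiv> minimum ((\<lambda>x. peval p x / peval q x) ` K)"
  shows "(\<forall>\<epsilon> :: nat \<Rightarrow> real. \<epsilon> \<longlonglongrightarrow> 0 \<longrightarrow>
            (\<forall>f :: 'n rpoly.
               big_O_pos (\<lambda>r. polynomial_upper_bound K \<mu> f r - minimum (peval f ` K)) \<epsilon>) \<longrightarrow>
            big_O_pos (\<lambda>r. rational_upper_bound K \<mu> p q r - val) \<epsilon>)
       \<and> (CARD('n) \<ge> 2 \<longrightarrow> K = sphere 0 1 \<longrightarrow> \<mu> = sphere_surface_measure \<longrightarrow>
            big_O_pos (\<lambda>r. rational_upper_bound K \<mu> p q r - val) (\<lambda>r. 1 / (real r)^2))"
proof (intro conjI allI impI)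
  interpret finite_measure_on_compact K \<mu>
    using assms by (simp add: finite_measure_on_compact_def finite_measure_on_compact_axioms_def)
  have q: "\<And>x. x \<in> K \<Longrightarrow> peval q x > 0"
    using assms(6) by blast
  have val: "val = minimum ((\<lambda>x. peval p x / peval q x) ` K)"
    by (simp add: val_def)
  have transfer: "big_O_pos (\<lambda>r. rational_upper_bound K \<mu> p q r - val) \<epsilon>"
    if "measure \<mu> K > 0"
      "\<And>f. big_O_pos (\<lambda>r. polynomial_upper_bound K \<mu> f r - minimum (peval f ` K)) \<epsilon>" for \<epsilon>
    using q that(1) \<open>K \<noteq> {}\<close> val that(2) by (rule big_O_rational_upper_bound)
  {
    fix \<epsilon> :: "nat \<Rightarrow> real"
    assume "\<epsilon> \<longlonglongrightarrow> 0"
      and rate: "\<forall>f. big_O_pos (\<lambda>r. polynomial_upper_bound K \<mu> f r - minimum (peval f ` K)) \<epsilon>"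
    then have "measure \<mu> K > 0"
      using measure_pos_of_polynomial_rates[OF \<open>K \<noteq> {}\<close>] by blast
    then show "big_O_pos (\<lambda>r. rational_upper_bound K \<mu> p q r - val) \<epsilon>"
      by (rule transfer[OF _ rate[rule_format]])
  }
  assume K: "K = sphere 0 1" and \<mu>: "\<mu> = sphere_surface_measure"
  have fin: "finite_measure (sphere_surface_measure :: (real ^ 'n) measure)"
    using \<open>finite_measure \<mu>\<close> \<mu> by simp
  have pos: "measure \<mu> K > 0"
    unfolding K \<mu> using fin by (rule measure_sphere_pos)
  have "big_O_pos (\<lambda>r. polynomial_upper_bound K \<mu> f r - minimum (peval f ` K)) (\<lambda>r. 1 / (real r)\<^sup>2)"
    for f :: "'n rpoly"
  proof -
    have cont: "continuous_on K (peval f)"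
      by (intro continuous_intros)
    obtain a where a: "a \<in> K" "minimum (peval f ` K) = peval f a" "\<And>x. x \<in> K \<Longrightarrow> peval f a \<le> peval f x"
      by (rule minimum_continuous_image[OF \<open>compact K\<close> \<open>K \<noteq> {}\<close> cont]) blast
    have norm_a: "norm a = 1"
      using a(1) K by simp
    have min: "peval f a \<le> peval f x" if "norm x = 1" for x
      using a(3) that K by simp
    obtain C where C: "C \<ge> 0" "\<And>x. norm x = 1 \<Longrightarrow> peval f x - peval f a \<le> C * (1 - a \<bullet> x)"
      using quadratic_growth_on_sphere[OF norm_a min] by blast
    have u: "\<bar>a \<bullet> x\<bar> \<le> 1" if "x \<in> K" for x
      using Cauchy_Schwarz_ineq2[of a x] that norm_a K by simp
    have "big_O_pos (\<lambda>r. polynomial_upper_bound K \<mu> f r - peval f a) (\<lambda>r. 1 / (real r)\<^sup>2)"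
    proof (rule big_O_polynomial_upper_bound[OF a(1,3) _ _ _ C(1) _ _ pos])
      show "measure \<mu> {x \<in> K. 1 - a \<bullet> x \<le> 4 * \<delta>} \<le> 64 ^ CARD('n) * measure \<mu> {x \<in> K. 1 - a \<bullet> x \<le> \<delta>}"
        if "\<delta> > 0" for \<delta>
        unfolding K \<mu> by (rule measure_cap_doubling[OF fin norm_a that])
    qed (use u C(2) K in \<open>force simp: abs_le_iff\<close>)+
    then show ?thesis
      by (simp add: a(2))
  qed
  then show "big_O_pos (\<lambda>r. rational_upper_bound K \<mu> p q r - val) (\<lambda>r. 1 / (real r)^2)"
    by (rule transfer[OF pos])
qed

end
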